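(* The symmetric inverse monoid $I_{\mathbb N}$ has countably infinitely many distinct Polish semigroup topologies.
   Context: $I_{\mathbb N}$ is the symmetric inverse monoid on $\mathbb N$: all bijections between subsets of $\mathbb N$ (including the empty map), with multiplication the composition of binary relations. A Polish semigroup topology on $I_{\mathbb N}$ is a Polish (separable completely metrizable) topology for which the multiplication $I_{\mathbb N}\times I_{\mathbb N}\to I_{\mathbb N}$ is (jointly) continuous. *)

theory Defs
  imports "HOL-Analysis.Analysis"
begin

text \<open>
  The elements of the symmetric inverse monoid on \<open>X\<close> are the (graphs of) bijections
  between subsets of \<open>X\<close>. The product of \<open>f\<close> and \<open>g\<close> is the relational composition
  \<open>f O g\<close>, that is, first \<open>f\<close>, then \<open>g\<close>.
\<close>

definition sym_inv_monoid :: "'a set \<Rightarrow> ('a \<times> 'a) set set" where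
  "sym_inv_monoid X =
     {{(x, f x) | x. x \<in> A} | f A B. A \<subseteq> X \<and> B \<subseteq> X \<and> bij_betw f A B}"

lemma sym_inv_monoid_iff:
  "R \<in> sym_inv_monoid X \<longleftrightarrow> R \<subseteq> X \<times> X \<and> single_valued R \<and> single_valued (R\<inverse>)"
proof
  assume "R \<in> sym_inv_monoid X"
  then show "R \<subseteq> X \<times> X \<and> single_valued R \<and> single_valued (R\<inverse>)"
    by (auto simp: sym_inv_monoid_def bij_betw_def single_valued_def inj_on_def)
next
  assume R: "R \<subseteq> X \<times> X \<and> single_valued R \<and> single_valued (R\<inverse>)"
  define f where "f x = (THE y. (x, y) \<in> R)" for x
  have f: "f x = y" if "(x, y) \<in> R" for x y
    using R that unfolding f_def single_valued_def by (intro the_equality) blast+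
  have dom: "(x, f x) \<in> R" if "x \<in> Domain R" for x
    using that f by blast
  have "inj_on f (Domain R)"
  proof (rule inj_onI)
    fix x y assume "x \<in> Domain R" "y \<in> Domain R" "f x = f y"
    then have "(x, f x) \<in> R" "(y, f x) \<in> R"
      using dom[of x] dom[of y] by simp_all
    then show "x = y"
      using R unfolding single_valued_def by blast
  qed
  moreover have "f ` Domain R = Range R"
    using f dom by blast
  ultimately have "bij_betw f (Domain R) (Range R)"
    by (simp add: bij_betw_def)
  moreover have "R = {(x, f x) | x. x \<in> Domain R}"
  proof (rule set_eqI)
    fix p show "p \<in> R \<longleftrightarrow> p \<in> {(x, f x) | x. x \<in> Domain R}"
      using dom f by (cases p) auto
  qed
  moreover have "Domain R \<subseteq> X" "Range R \<subseteq> X"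
    using R by auto
  ultimately show "R \<in> sym_inv_monoid X"
    unfolding sym_inv_monoid_def by blast
qed

lemma relcomp_in_sym_inv_monoid:
  "R \<in> sym_inv_monoid X \<Longrightarrow> S \<in> sym_inv_monoid X \<Longrightarrow> R O S \<in> sym_inv_monoid X"
  unfolding sym_inv_monoid_iff single_valued_def by blast

definition Polish_space :: "'a topology \<Rightarrow> bool" where
  "Polish_space T \<longleftrightarrow> separable_space T \<and> completely_metrizable_space T"

definition semigroup_topology_on :: "'a set \<Rightarrow> ('a \<Rightarrow> 'a \<Rightarrow> 'a) \<Rightarrow> 'a topology \<Rightarrow> bool" where
  "semigroup_topology_on S m T \<longleftrightarrow>
     topspace T = S \<and> continuous_map (prod_topology T T) T (\<lambda>(x, y). m x y)"

end

theory Submission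
  imports Defs "HOL-Combinatorics.Permutations"
begin

text \<open>
  Let \<open>T\<close> be a Polish semigroup topology. Multiplying by rank-one idempotents shows that membership
  of a pair \<open>(x, y)\<close> is a clopen condition. In the other direction, a diagonal argument in the
  style of the small index property shows that every \<open>T\<close>-neighbourhood of a chart \<open>s\<close> contains all
  charts which, together with their inverses, agree with \<open>s\<close> on some \<open>{..<n}\<close>.

  What remains undetermined is how many points \<open>x \<notin> Domain f\<close> and \<open>y \<notin> Range f\<close> can be defined
  in charts \<open>T\<close>-close to \<open>f\<close> (with image, respectively preimage, escaping to infinity). So
  \<open>T\<close> is determined by the closures of the sets \<open>spanning A B\<close> of charts defined on \<open>A\<close> and onto
  \<open>B\<close>. By continuity of multiplication and approximation by finite charts, membership of \<open>f\<close> in such a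
  closure depends only on which triples (rank, size of \<open>A\<close>, size of \<open>B\<close>) occur for finite
  charts; these triples form a downward closed subset of \<open>nat \<times> nat \<times> nat\<close>, and by Dickson's
  lemma there are only countably many such subsets.

  Conversely, for every \<open>k\<close> the topology generated by the conditions \<open>(x, y) \<in> h\<close>,
  \<open>x \<notin> Domain h\<close> and \<open>card (Range h \<inter> F) \<le> k\<close>, with \<open>F\<close> finite, is a Polish semigroup topology,
  and these are pairwise distinct.
\<close>

section \<open>Permutations of the natural numbers\<close>

text \<open>Continuity of inversion is not assumed, so neighbourhoods of \<open>Id\<close> cannot be
  made symmetric. Permutations are instead sorted into countably many classes by basic
  neighbourhoods of both \<open>p\<close> and \<open>inv p\<close>, and quotients within one class
  are automatically close to \<open>Id\<close>. Only products of boundedly many small elements stay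
  small, so near-identity permutations have to be written as one fixed word in such quotients. Each
  single pair is a clopen condition, so a chart near \<open>f\<close> can be defined at a point
  outside \<open>Domain f\<close> only with a value that escapes to infinity. This is the only
  freedom left to the topology, and the sets \<open>spanning A B\<close> measure it. In the examples
  the domain is fully controlled and only the range is loosened. The difficulty is then the range of
  a product. It is overcome by noting that \<open>k\<close> range points of \<open>g\<close>, shared
  by all nearby charts, use up the whole allowance \<open>k\<close>, so that no further range point
  can appear.\<close>

lemma ex_permutes_extending:
  fixes f :: "nat \<Rightarrow> nat"
  assumes f: "bij_betw f A B" and sub: "A \<subseteq> N" "B \<subseteq> N"
    and inf: "infinite (N - A)" "infinite (N - B)"
  obtains g where "g permutes N" "\<And>x. x \<in> A \<Longrightarrow> g x = f x"
proof -
  define h where "h = from_nat_into (N - B) \<circ> to_nat_on (N - A)"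
  have h: "bij_betw h (N - A) (N - B)"
    unfolding h_def
    by (rule bij_betw_trans[OF to_nat_on_infinite bij_betw_from_nat_into]) (use inf in auto)
  define g where "g x = (if x \<in> A then f x else if x \<in> N then h x else x)" for x
  have gA: "bij_betw g A B"
    using f by (rule bij_betw_cong[THEN iffD1, rotated]) (simp add: g_def)
  have gN: "bij_betw g (N - A) (N - B)"
    using h by (rule bij_betw_cong[THEN iffD1, rotated]) (simp add: g_def)
  have "bij_betw g (A \<union> (N - A)) (B \<union> (N - B))"
    by (rule bij_betw_combine[OF gA gN]) blast
  then have "bij_betw g N N"
    using sub by (simp add: Un_absorb1)
  then have "g permutes N"
    by (rule bij_imp_permutes) (use sub in \<open>auto simp: g_def\<close>)
  then show thesis
    using that by (simp add: g_def)
qed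

text \<open>If every stage failed, the failing permutations of the \<open>M n\<close> and the finite
  approximations on \<open>Q\<close> would glue to a permutation outside all \<open>S n\<close>.\<close>

lemma cover_rich_piece:
  fixes S :: "nat \<Rightarrow> (nat \<Rightarrow> nat) set"
  assumes cover: "\<And>p. bij p \<Longrightarrow> \<exists>n. p \<in> S n"
    and disj: "\<And>i j. i \<noteq> j \<Longrightarrow> M i \<inter> M j = {}" "\<And>i. M i \<inter> Q = {}"
    and un: "Q \<union> (\<Union>i. M i) = UNIV"
  obtains n F a where "finite F" "F \<subseteq> Q" "a permutes Q"
    "\<And>\<sigma> b G. \<lbrakk>\<sigma> permutes M n; b permutes Q; finite G; G \<subseteq> Q; \<And>x. x \<in> F \<Longrightarrow> b x = a x\<rbrakk>
      \<Longrightarrow> \<exists>s\<in>S n. (\<forall>x\<in>M n. s x = \<sigma> x) \<and> (\<forall>x\<in>F \<union> G. s x = b x)"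
proof (rule ccontr)
  assume neg: "\<not> thesis"
  define OK where "OK p \<longleftrightarrow> finite (fst p) \<and> fst p \<subseteq> Q \<and> snd p permutes Q"
    for p :: "nat set \<times> (nat \<Rightarrow> nat)"
  \<comment> \<open>Stage \<open>n\<close> chooses a permutation of \<open>M n\<close> that no
    member of \<open>S n\<close> extends compatibly with the new finite data. The clause on
    \<open>n\<close> puts every point of \<open>Q\<close> into both the domain and the image of the
    finite data at some stage, so the limit is onto as well as total on \<open>Q\<close>.\<close>
  define R where "R n p q \<longleftrightarrow> fst p \<subseteq> fst q \<and> (\<forall>x\<in>fst p. snd q x = snd p x) \<and>
      (n \<in> Q \<longrightarrow> n \<in> fst q \<and> n \<in> snd q ` fst q) \<and>
      (\<exists>\<sigma>. \<sigma> permutes M n \<and> (\<forall>s\<in>S n. (\<forall>x\<in>M n. s x = \<sigma> x) \<longrightarrow> (\<exists>x\<in>fst q. s x \<noteq> snd q x)))"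
    for n and p q :: "nat set \<times> (nat \<Rightarrow> nat)"
  have "\<exists>P. \<forall>n. OK (P n) \<and> R n (P n) (P (Suc n))"
  proof (rule dependent_nat_choice)
    show "\<exists>p. OK p"
      by (rule exI[of _ "({}, id)"]) (simp add: OK_def)
  next
    fix p n assume p: "OK p"
    obtain F a where pe: "p = (F, a)" by fastforce
    have "\<exists>\<sigma> b G. \<sigma> permutes M n \<and> b permutes Q \<and> finite G \<and> G \<subseteq> Q \<and> (\<forall>x\<in>F. b x = a x)
       \<and> \<not> (\<exists>s\<in>S n. (\<forall>x\<in>M n. s x = \<sigma> x) \<and> (\<forall>x\<in>F \<union> G. s x = b x))"
    proof (rule ccontr)
      assume "\<not> ?thesis"
      then have "\<And>\<sigma> b G. \<lbrakk>\<sigma> permutes M n; b permutes Q; finite G; G \<subseteq> Q; \<And>x. x \<in> F \<Longrightarrow> b x = a x\<rbrakk>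
          \<Longrightarrow> \<exists>s\<in>S n. (\<forall>x\<in>M n. s x = \<sigma> x) \<and> (\<forall>x\<in>F \<union> G. s x = b x)"
        by blast
      then have thesis
        using p by (intro that[of F a n]) (simp_all add: OK_def pe)
      then show False using neg by contradiction
    qed
    then obtain \<sigma> b G where s: "\<sigma> permutes M n" "b permutes Q" "finite G" "G \<subseteq> Q"
        "\<forall>x\<in>F. b x = a x"
        "\<not> (\<exists>s\<in>S n. (\<forall>x\<in>M n. s x = \<sigma> x) \<and> (\<forall>x\<in>F \<union> G. s x = b x))"
      by blast
    define q where "q = (F \<union> G \<union> ({n, inv b n} \<inter> Q), b)"
    have "b (inv b n) = n" "n \<in> Q \<longrightarrow> inv b n \<in> Q"
      using s(2) by (auto simp: permutes_inverses permutes_in_image permutes_inv)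
    then have "n \<in> Q \<longrightarrow> n \<in> fst q \<and> n \<in> snd q ` fst q"
      unfolding q_def by (auto simp: image_iff)
    moreover have "\<forall>s\<in>S n. (\<forall>x\<in>M n. s x = \<sigma> x) \<longrightarrow> (\<exists>x\<in>fst q. s x \<noteq> snd q x)"
      using s(6) unfolding q_def by fastforce
    ultimately have "R n p q"
      unfolding R_def using s(1,5) by (auto simp: pe q_def)
    moreover have "OK q"
      using p s unfolding OK_def pe q_def by auto
    ultimately show "\<exists>q. OK q \<and> R n p q" by blast
  qed
  then obtain P where P: "\<And>n. OK (P n)" "\<And>n. R n (P n) (P (Suc n))" by blast
  define F where "F n = fst (P n)" for n
  define a where "a n = snd (P n)" for n
  have aQ: "a n permutes Q" and FQ: "F n \<subseteq> Q" for n
    using P(1)[of n] by (auto simp: OK_def F_def a_def)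
  have step: "F n \<subseteq> F (Suc n)" "\<And>x. x \<in> F n \<Longrightarrow> a (Suc n) x = a n x"
    and inF: "n \<in> Q \<Longrightarrow> n \<in> F (Suc n)" "n \<in> Q \<Longrightarrow> n \<in> a (Suc n) ` F (Suc n)" for n
    using P(2)[of n] by (auto simp: R_def F_def a_def)
  have "\<exists>\<sigma>. \<forall>n. \<sigma> n permutes M n \<and> (\<forall>s\<in>S n. (\<forall>x\<in>M n. s x = \<sigma> n x) \<longrightarrow> (\<exists>x\<in>F (Suc n). s x \<noteq> a (Suc n) x))"
    using P(2) unfolding R_def F_def a_def by metis
  then obtain \<sigma> where \<sigma>: "\<And>n. \<sigma> n permutes M n"
    "\<And>n s. \<lbrakk>s \<in> S n; \<forall>x\<in>M n. s x = \<sigma> n x\<rbrakk> \<Longrightarrow> \<exists>x\<in>F (Suc n). s x \<noteq> a (Suc n) x" by blast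
  have mono: "F m \<subseteq> F n" "\<And>x. x \<in> F m \<Longrightarrow> a n x = a m x" if "m \<le> n" for m n
  proof -
    have "F m \<subseteq> F n \<and> (\<forall>x\<in>F m. a n x = a m x)"
      using that
    proof (induction n rule: dec_induct)
      case (step k) then show ?case using step(1) \<open>\<And>n. F n \<subseteq> F (Suc n)\<close> \<open>\<And>x n. x \<in> F n \<Longrightarrow> a (Suc n) x = a n x\<close>
        by (metis subset_eq)
    qed auto
    then show "F m \<subseteq> F n" "\<And>x. x \<in> F m \<Longrightarrow> a n x = a m x" by auto
  qed
  define idx where "idx x = (THE i. x \<in> M i)" for x
  have idx: "idx x = i" if "x \<in> M i" for x i
    unfolding idx_def using that disj(1) by blast
  define s where "s x = (if x \<in> Q then a (Suc x) x else \<sigma> (idx x) x)" for x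
  have sF: "s x = a n x" if "x \<in> F n" for x n
  proof -
    have "x \<in> Q" "x \<in> F (Suc x)"
      using that FQ inF(1) by auto
    then show ?thesis
      using mono(2)[of n "max n (Suc x)" x] mono(2)[of "Suc x" "max n (Suc x)" x] that
      by (simp add: s_def)
  qed
  have sM: "s x = \<sigma> n x" if "x \<in> M n" for x n
    using that disj(2)[of n] idx by (auto simp: s_def)
  have sMM: "s x \<in> M n" if "x \<in> M n" for x n
    using that sM \<sigma>(1)[of n] by (simp add: permutes_in_image)
  have sQ: "s x \<in> Q" if "x \<in> Q" for x
    using that aQ[of "Suc x"] by (simp add: s_def permutes_in_image)
  have "inj s"
  proof (rule injI)
    fix x y assume e: "s x = s y"
    consider i where "x \<in> M i" | "x \<in> Q" using un by blast
    then show "x = y"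
    proof cases
      case 1
      then have "y \<in> M i"
        using e sMM sQ disj un by (metis Int_iff UNIV_I UN_iff UnE empty_iff)
      then show ?thesis
        using e 1 sM \<sigma>(1)[of i] by (metis permutes_inv_eq)
    next
      case 2
      then have y: "y \<in> Q"
        using e sMM sQ disj un by (metis Int_iff UNIV_I UN_iff UnE empty_iff)
      define m where "m = max (Suc x) (Suc y)"
      have "x \<in> F m" "y \<in> F m"
        using inF(1)[OF 2] inF(1)[OF y] mono(1)[of "Suc x" m] mono(1)[of "Suc y" m]
        by (auto simp: m_def)
      then show ?thesis
        using e sF aQ[of m] by (metis permutes_inv_eq)
    qed
  qed
  moreover have "surj s"
  proof (rule surjI[of _ "\<lambda>y. SOME x. s x = y"])
    fix y
    have "\<exists>x. s x = y"
    proof (cases "y \<in> Q")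
      case True
      then show ?thesis using inF(2) sF by (metis imageE)
    next
      case False
      then obtain i where "y \<in> M i" using un by blast
      then have "inv (\<sigma> i) y \<in> M i" "\<sigma> i (inv (\<sigma> i) y) = y"
        using \<sigma>(1)[of i] by (auto simp: permutes_inverses permutes_in_image permutes_inv)
      then show ?thesis using sM by metis
    qed
    then show "s (SOME x. s x = y) = y" by (rule someI_ex)
  qed
  ultimately have "bij s" by (simp add: bij_def)
  then obtain n where n: "s \<in> S n" using cover by blast
  then obtain x where "x \<in> F (Suc n)" "s x \<noteq> a (Suc n) x"
    using \<sigma>(2) sM by blast
  then show False using sF by blast
qed

section \<open>Almost disjoint sets and quotients of covering classes\<close>

lemma ex_almost_disjoint_family:
  obtains B :: "nat set \<Rightarrow> nat set"
  where "\<And>\<alpha>. infinite (B \<alpha>)" "\<And>\<alpha>. B \<alpha> \<subseteq> {n. even n}"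
    "\<And>\<alpha> \<beta>. \<alpha> \<noteq> \<beta> \<Longrightarrow> finite (B \<alpha> \<inter> B \<beta>)"
proof
  \<comment> \<open>Branches of the binary tree: \<open>e \<alpha> n\<close> codes the first
    \<open>n\<close> bits of \<alpha>, so two distinct sets share only the codes of common initial
    segments. The factor 2 leaves the odd numbers free as room outside all members of the
    family.\<close>
  define e where "e \<alpha> n = 2 * prod_encode (n, set_encode (\<alpha> \<inter> {..<n}))" for \<alpha> n
  have e_eq: "n = m \<and> \<alpha> \<inter> {..<n} = \<beta> \<inter> {..<n}" if "e \<alpha> n = e \<beta> m" for \<alpha> \<beta> n m
  proof -
    have "(n, set_encode (\<alpha> \<inter> {..<n})) = (m, set_encode (\<beta> \<inter> {..<m}))"
      using that unfolding e_def
      by (metis mult_cancel1 prod_encode_eq zero_neq_numeral)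
    then show ?thesis
      by (auto simp: set_encode_eq)
  qed
  show "infinite (range (e \<alpha>))" for \<alpha>
    by (rule range_inj_infinite) (use e_eq in \<open>auto simp: inj_def\<close>)
  show "range (e \<alpha>) \<subseteq> {n. even n}" for \<alpha>
    by (auto simp: e_def)
  show "finite (range (e \<alpha>) \<inter> range (e \<beta>))" if ne: "\<alpha> \<noteq> \<beta>" for \<alpha> \<beta>
  proof -
    obtain k where k: "(k \<in> \<alpha>) \<noteq> (k \<in> \<beta>)"
      using ne by blast
    have "range (e \<alpha>) \<inter> range (e \<beta>) \<subseteq> e \<alpha> ` {..k}"
    proof
      fix x assume "x \<in> range (e \<alpha>) \<inter> range (e \<beta>)"
      then obtain n m where x: "x = e \<alpha> n" "x = e \<beta> m" by blast
      then have "\<alpha> \<inter> {..<n} = \<beta> \<inter> {..<n}"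
        using e_eq[of \<alpha> n \<beta> m] by metis
      then have "\<not> k < n"
        using k by blast
      then show "x \<in> e \<alpha> ` {..k}"
        using x by auto
    qed
    then show ?thesis
      by (rule finite_subset) simp
  qed
qed

text \<open>Stand-in for a neighbourhood of the identity, with \<open>S\<close> a countable cover of
  the permutations. The order \<open>inv s \<circ> t\<close> fits relational composition, where its
  graph is \<open>fgraph t O fgraph (inv s)\<close>.\<close>

definition quotients :: "(nat \<Rightarrow> ('a \<Rightarrow> 'a) set) \<Rightarrow> ('a \<Rightarrow> 'a) set" where
  "quotients S = {inv s \<circ> t | s t n. s \<in> S n \<and> t \<in> S n}"

lemma quotients_bij:
  assumes "\<And>n. S n \<subseteq> Collect bij" "y \<in> quotients S"
  shows "bij y" "inv y \<in> quotients S"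
proof -
  obtain s t n where y: "y = inv s \<circ> t" "s \<in> S n" "t \<in> S n"
    using assms(2) unfolding quotients_def by blast
  then have b: "bij s" "bij t"
    using assms(1) by auto
  then show "bij y"
    by (simp add: y bij_comp bij_imp_bij_inv)
  have "inv y = inv t \<circ> s"
    using b by (simp add: y o_inv_distrib bij_imp_bij_inv inv_inv_eq)
  then show "inv y \<in> quotients S"
    using y unfolding quotients_def by blast
qed

lemma infinite_parity: "infinite {n::nat. even n}" "infinite {n::nat. odd n}"
proof -
  have "inj (\<lambda>n::nat. 2 * n)" "inj (\<lambda>n::nat. 2 * n + 1)"
    by (simp_all add: inj_def)
  then have "infinite (range (\<lambda>n::nat. 2 * n))" "infinite (range (\<lambda>n::nat. 2 * n + 1))"
    by (simp_all only: range_inj_infinite not_False_eq_True)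
  moreover have "range (\<lambda>n::nat. 2 * n) \<subseteq> {n. even n}" "range (\<lambda>n::nat. 2 * n + 1) \<subseteq> {n. odd n}"
    by auto
  ultimately show "infinite {n::nat. even n}" "infinite {n::nat. odd n}"
    using finite_subset by blast+
qed

lemma infinite_split:
  fixes X :: "nat set"
  assumes "infinite X"
  obtains Y where "Y \<subseteq> X" "infinite Y" "infinite (X - Y)"
proof
  let ?f = "from_nat_into X"
  have b: "bij_betw ?f UNIV X"
    using assms by (simp add: bij_betw_from_nat_into)
  then have i: "inj ?f" and r: "range ?f = X"
    by (auto simp: bij_betw_def)
  show "?f ` {n. even n} \<subseteq> X" using r by blast
  show "infinite (?f ` {n. even n})"
    using infinite_parity i by (metis finite_image_iff inj_on_subset subset_UNIV)
  have "?f ` {n. odd n} \<subseteq> X - ?f ` {n. even n}"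
    using r i by (auto simp: inj_def)
  moreover have "infinite (?f ` {n. odd n})"
    using infinite_parity i by (metis finite_image_iff inj_on_subset subset_UNIV)
  ultimately show "infinite (X - ?f ` {n. even n})"
    using finite_subset by blast
qed

lemma ex_bij_betw_infinite:
  fixes A B :: "nat set"
  assumes "infinite A" "infinite B"
  obtains f where "bij_betw f A B"
proof
  show "bij_betw (from_nat_into B \<circ> to_nat_on A) A B"
    by (rule bij_betw_trans[OF to_nat_on_infinite bij_betw_from_nat_into]) (use assms in auto)
qed

text \<open>Uncountably many permutations fall into countably many classes, so two of those carrying
  \<open>C\<close> to almost disjoint sets have a common class.\<close>

lemma ex_almost_disjoint_quotient:
  fixes S :: "nat \<Rightarrow> (nat \<Rightarrow> nat) set"
  assumes cover: "\<And>p. bij p \<Longrightarrow> \<exists>n. p \<in> S n"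
    and inf: "infinite C" "infinite (N - C)" and CN: "C \<subseteq> N"
  obtains g where "g \<in> quotients S" "g permutes N" "finite (C \<inter> g ` C)"
    "infinite (N - (C \<union> g ` C))"
proof -
  obtain B :: "nat set \<Rightarrow> nat set" where B: "\<And>\<alpha>. infinite (B \<alpha>)" "\<And>\<alpha>. B \<alpha> \<subseteq> {n. even n}"
    "\<And>\<alpha> \<beta>. \<alpha> \<noteq> \<beta> \<Longrightarrow> finite (B \<alpha> \<inter> B \<beta>)"
    using ex_almost_disjoint_family by blast
  define \<theta> where "\<theta> = from_nat_into N"
  have "infinite N" using inf(2) by auto
  then have \<theta>: "bij_betw \<theta> UNIV N"
    unfolding \<theta>_def by (simp add: bij_betw_from_nat_into)
  have i\<theta>: "inj_on \<theta> X" for X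
    using \<theta> by (meson bij_betw_def inj_on_subset subset_UNIV)
  have r\<theta>: "\<theta> ` X \<subseteq> N" for X
    using \<theta> by (auto simp: bij_betw_def)
  have \<theta>N: "\<theta> x \<in> N" for x
    using \<theta> by (simp add: bij_betw_apply)
  have \<theta>_eq: "\<theta> x = \<theta> y \<longleftrightarrow> x = y" for x y
    using inj_eq[OF i\<theta>[of UNIV]] .
  \<comment> \<open>The odd positions of the enumeration of \<open>N\<close> avoid the image of
    every \<open>B \<alpha>\<close>. They make each image co-infinite in \<open>N\<close>, so that a
    permutation of \<open>N\<close> can carry \<open>C\<close> onto it, and they also provide the
    infinite remainder outside \<open>C\<close> and its image under \<open>g\<close>.\<close>
  have odd: "infinite (\<theta> ` {n. odd n})"
    using infinite_parity(2) finite_imageD i\<theta> by blast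
  have "\<exists>g. g permutes N \<and> g ` C = \<theta> ` B \<alpha>" for \<alpha>
  proof -
    have "infinite (\<theta> ` B \<alpha>)"
      using B(1) finite_imageD i\<theta> by blast
    then obtain f where f: "bij_betw f C (\<theta> ` B \<alpha>)"
      using ex_bij_betw_infinite inf(1) by blast
    have "\<theta> ` {n. odd n} \<subseteq> N - \<theta> ` B \<alpha>"
      using B(2)[of \<alpha>] by (auto simp: \<theta>N \<theta>_eq)
    then have "infinite (N - \<theta> ` B \<alpha>)"
      using odd finite_subset by blast
    then obtain g where g: "g permutes N" "\<And>x. x \<in> C \<Longrightarrow> g x = f x"
      using ex_permutes_extending[OF f CN r\<theta> inf(2)] by blast
    have "g ` C = \<theta> ` B \<alpha>"
      using g(2) f by (auto simp: bij_betw_def)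
    with g show ?thesis by blast
  qed
  then obtain G where G: "\<And>\<alpha>. G \<alpha> permutes N" "\<And>\<alpha>. G \<alpha> ` C = \<theta> ` B \<alpha>"
    by metis
  have "\<exists>n. G \<alpha> \<in> S n" for \<alpha>
    using cover G(1) permutes_bij by blast
  then obtain c where c: "\<And>\<alpha>. G \<alpha> \<in> S (c \<alpha>)" by metis
  have "\<not> inj c"
  proof
    assume "inj c"
    then have "surj (inv c)" by (rule inj_imp_surj_inv)
    then show False
      using Cantors_theorem[of "UNIV :: nat set"] by auto
  qed
  then obtain \<alpha> \<beta> where ab: "\<alpha> \<noteq> \<beta>" "c \<alpha> = c \<beta>"
    by (auto simp: inj_def)
  define g where "g = inv (G \<alpha>) \<circ> G \<beta>"
  have inj: "inj (G \<alpha>)" using G(1) permutes_inj by blast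
  have Gg: "G \<alpha> ` g ` X = G \<beta> ` X" for X
    using G(1)[of \<alpha>] by (simp add: g_def image_image permutes_inverses)
  show thesis
  proof
    show "g \<in> quotients S"
      unfolding quotients_def g_def using c[of \<alpha>] c[of \<beta>] ab(2) by auto
    show gN: "g permutes N"
      unfolding g_def using G(1) by (intro permutes_compose permutes_inv)
    have "G \<alpha> ` (C \<inter> g ` C) = \<theta> ` B \<alpha> \<inter> \<theta> ` B \<beta>"
      using G(2) Gg inj by (simp add: image_Int)
    also have "\<dots> = \<theta> ` (B \<alpha> \<inter> B \<beta>)"
      using i\<theta> by (simp add: image_Int)
    finally have "finite (G \<alpha> ` (C \<inter> g ` C))"
      using B(3) ab(1) by simp
    then show "finite (C \<inter> g ` C)"
      using inj by (meson finite_imageD inj_on_subset subset_UNIV)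
    have "G \<alpha> ` (N - (C \<union> g ` C)) = N - (\<theta> ` B \<alpha> \<union> \<theta> ` B \<beta>)"
      using G Gg inj by (simp add: image_set_diff image_Un permutes_image)
    moreover have "\<theta> ` {n. odd n} \<subseteq> N - (\<theta> ` B \<alpha> \<union> \<theta> ` B \<beta>)"
      using B(2)[of \<alpha>] B(2)[of \<beta>] by (auto simp: \<theta>N \<theta>_eq)
    ultimately have "infinite (G \<alpha> ` (N - (C \<union> g ` C)))"
      using odd finite_subset by metis
    then show "infinite (N - (C \<union> g ` C))" by blast
  qed
qed

lemma permutes_conj:
  assumes "bij y" "q permutes C"
  shows "(y \<circ> q \<circ> inv y) permutes (y ` C)"
proof (rule bij_imp_permutes)
  have "inv y ` y ` C = C"
    using assms(1) by (simp add: bij_is_inj)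
  then have "(y \<circ> q \<circ> inv y) ` y ` C = y ` C"
    by (simp only: image_comp[symmetric] permutes_image[OF assms(2)])
  moreover have "inj (y \<circ> q \<circ> inv y)"
    using assms by (intro inj_compose) (auto simp: bij_is_inj bij_imp_bij_inv permutes_inj)
  ultimately show "bij_betw (y \<circ> q \<circ> inv y) (y ` C) (y ` C)"
    by (simp add: bij_betw_def) (meson inj_on_subset subset_UNIV)
  fix x assume "x \<notin> y ` C"
  then have "inv y x \<notin> C"
    using assms(1) by (metis bij_inv_eq_iff imageI)
  then show "(y \<circ> q \<circ> inv y) x = x"
    using assms by (simp add: permutes_not_in bij_is_surj surj_f_inv_f)
qed

text \<open>Let \<open>C = Q - F\<close>. Quotients can be prescribed on a moiety \<open>M\<close> disjoint from \<open>Q\<close> and, at the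
  same time, on any finite part of \<open>C\<close>. Some quotient \<open>g\<close> moves all but finitely many points of
  \<open>C\<close> into \<open>M\<close>; choosing \<open>h\<close> so that \<open>h ` g ` C\<close> avoids the exceptional points, \<open>g \<circ> h \<circ> g\<close>
  maps \<open>C\<close> into \<open>M\<close> and so conjugates permutations of \<open>C\<close> to permutations of \<open>M\<close>.\<close>

lemma quotients_extend_near_identity:
  fixes S :: "nat \<Rightarrow> (nat \<Rightarrow> nat) set"
  assumes cover: "\<And>p. bij p \<Longrightarrow> \<exists>n. p \<in> S n"
    and bij: "\<And>n. S n \<subseteq> Collect bij"
    and inf: "infinite Q" "infinite (- Q)"
  obtains F where "finite F" "F \<subseteq> Q"
    "\<And>q. q permutes (Q - F) \<Longrightarrow> \<exists>g\<in>quotients S. \<exists>h\<in>quotients S. \<exists>k\<in>quotients S.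
        inv g \<in> quotients S \<and> inv h \<in> quotients S \<and>
        (\<forall>c\<in>Q. inv g (inv h (inv g (k (g (h (g c)))))) = q c)"
proof -
  define \<theta> where "\<theta> = from_nat_into (- Q)"
  have \<theta>: "bij_betw \<theta> UNIV (- Q)"
    unfolding \<theta>_def using inf by (simp add: bij_betw_from_nat_into)
  \<comment> \<open>Pairing cuts \<open>- Q\<close> into infinitely many infinite pieces, one for
    each class \<open>S n\<close>.\<close>
  define P where "P n = range (\<lambda>j. \<theta> (prod_encode (n, j)))" for n
  have inj\<theta>: "\<theta> x = \<theta> y \<longleftrightarrow> x = y" for x y
    using \<theta> by (auto simp: bij_betw_def inj_def)
  have P1: "P i \<inter> P j = {}" if "i \<noteq> j" for i j
    using that by (auto simp: P_def inj\<theta>)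
  have P2: "P i \<inter> Q = {}" for i
    using \<theta> by (auto simp: P_def bij_betw_def)
  have P3: "Q \<union> (\<Union>i. P i) = UNIV"
  proof -
    have "x \<in> (\<Union>i. P i)" if "x \<notin> Q" for x
    proof -
      have "x \<in> range \<theta>" using \<theta> that by (simp add: bij_betw_def)
      then obtain y where "x = \<theta> y" by blast
      then have "x = \<theta> (prod_encode (fst (prod_decode y), snd (prod_decode y)))" by simp
      then show ?thesis unfolding P_def by blast
    qed
    then show ?thesis by blast
  qed
  obtain n F a where F: "finite F" "F \<subseteq> Q" "a permutes Q" and
    ext: "\<And>\<sigma> b G. \<lbrakk>\<sigma> permutes P n; b permutes Q; finite G; G \<subseteq> Q; \<And>x. x \<in> F \<Longrightarrow> b x = a x\<rbrakk>
      \<Longrightarrow> \<exists>s\<in>S n. (\<forall>x\<in>P n. s x = \<sigma> x) \<and> (\<forall>x\<in>F \<union> G. s x = b x)"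
  proof (rule cover_rich_piece[of S P Q, OF cover P1 P2 P3])
    fix n F a
    assume "finite F" "F \<subseteq> Q" "a permutes Q"
      "\<And>\<sigma> b G. \<lbrakk>\<sigma> permutes P n; b permutes Q; finite G; G \<subseteq> Q; \<And>x. x \<in> F \<Longrightarrow> b x = a x\<rbrakk>
        \<Longrightarrow> \<exists>s\<in>S n. (\<forall>x\<in>P n. s x = \<sigma> x) \<and> (\<forall>x\<in>F \<union> G. s x = b x)"
    then show thesis
      by (rule that)
  qed
  define M where "M = P n"
  have MQ: "M \<inter> Q = {}" unfolding M_def by (rule P2)
  have infM: "infinite M"
    unfolding M_def P_def by (rule range_inj_infinite) (simp add: inj_def inj\<theta>)
  \<comment> \<open>The permutation \<open>a\<close> that comes with the rich piece is unknown and
    has to cancel. One element of \<open>S n\<close> is trivial on \<open>M\<close> and equals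
    \<open>a\<close> on \<open>F\<close> and the image of \<open>G\<close> under \<open>b\<close>;
    another equals \<sigma> on \<open>M\<close> and \<open>a \<circ> b\<close> on \<open>F\<close>
    and \<open>G\<close>. Their quotient is \<sigma> on \<open>M\<close> and \<open>b\<close> on
    \<open>F\<close> and \<open>G\<close>. Since \<open>b\<close> fixes \<open>F\<close>, both meet
    the requirement to agree with \<open>a\<close> there.\<close>
  have near: "\<exists>h\<in>quotients S. (\<forall>x\<in>M. h x = \<sigma> x) \<and> (\<forall>x\<in>F \<union> G. h x = b x)"
    if s: "\<sigma> permutes M" and b: "b permutes Q" "\<And>x. x \<in> F \<Longrightarrow> b x = x" and G: "finite G" "G \<subseteq> Q"
    for \<sigma> b G
  proof -
    have "b ` G \<subseteq> Q"
      using b(1) G(2) by (auto simp: permutes_in_image)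
    then have "\<exists>s\<in>S n. (\<forall>x\<in>P n. s x = id x) \<and> (\<forall>x\<in>F \<union> b ` G. s x = a x)"
      by (intro ext[of id a "b ` G"]) (use G F permutes_id in \<open>auto simp: id_def\<close>)
    then obtain s where s1: "s \<in> S n" "\<And>x. x \<in> M \<Longrightarrow> s x = x" "\<And>x. x \<in> F \<union> b ` G \<Longrightarrow> s x = a x"
      unfolding M_def by auto
    have "a \<circ> b permutes Q"
      using b(1) F(3) by (rule permutes_compose)
    then have "\<exists>t\<in>S n. (\<forall>x\<in>P n. t x = \<sigma> x) \<and> (\<forall>x\<in>F \<union> G. t x = (a \<circ> b) x)"
      by (intro ext[of \<sigma> "a \<circ> b" G]) (use s b G in \<open>auto simp: M_def\<close>)
    then obtain t where t1: "t \<in> S n" "\<And>x. x \<in> M \<Longrightarrow> t x = \<sigma> x" "\<And>x. x \<in> F \<union> G \<Longrightarrow> t x = a (b x)"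
      unfolding M_def by auto
    have sb: "inj s" using s1(1) bij bij_is_inj by blast
    have "inv s (t x) = \<sigma> x" if "x \<in> M" for x
      using that sb s1(2) t1(2) s by (metis inv_f_f permutes_in_image)
    moreover have "inv s (t x) = b x" if "x \<in> F \<union> G" for x
    proof -
      have "b x \<in> F \<union> b ` G" using that b(2) by auto
      then show ?thesis using that sb s1(3) t1(3) by (metis inv_f_f)
    qed
    moreover have "inv s \<circ> t \<in> quotients S"
      unfolding quotients_def using s1(1) t1(1) by blast
    ultimately show ?thesis by (intro bexI[of _ "inv s \<circ> t"]) auto
  qed
  define C where "C = Q - F"
  define N where "N = C \<union> M"
  have NC: "N - C = M" using MQ by (auto simp: N_def C_def)
  have infC: "infinite C" using inf(1) F(1) by (simp add: C_def)
  obtain g where g: "g \<in> quotients S" "g permutes N" "finite (C \<inter> g ` C)"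
    "infinite (N - (C \<union> g ` C))"
    using ex_almost_disjoint_quotient[OF cover infC, of N] NC infM by (auto simp: N_def)
  have gb: "bij g" "inj g" using g(2) by (auto simp: permutes_bij permutes_inj)
  have gN: "g x \<in> N \<longleftrightarrow> x \<in> N" for x using g(2) by (rule permutes_in_image)
  \<comment> \<open>\<open>K1\<close> holds the finitely many points of \<open>C\<close> that
    \<open>g\<close> fails to push into \<open>M\<close>, and \<open>F1\<close> their images.
    \<open>L\<close> is the part of the image of \<open>C\<close> that does land in
    \<open>M\<close>, and \<open>T\<close> the part of \<open>M\<close> that a second
    \<open>g\<close> leaves inside \<open>M\<close>.\<close>
  define F1 where "F1 = C \<inter> g ` C"
  define K1 where "K1 = {c \<in> C. g c \<in> C}"
  define L where "L = g ` C - C"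
  define T where "T = {x \<in> M. g x \<in> M}"
  have "g ` K1 \<subseteq> F1" by (auto simp: K1_def F1_def)
  then have K1: "finite K1"
    using g(3) gb(2) unfolding F1_def by (meson finite_imageD finite_subset inj_on_subset subset_UNIV)
  have "inv g ` (N - (C \<union> g ` C)) \<subseteq> T"
  proof
    fix x assume "x \<in> inv g ` (N - (C \<union> g ` C))"
    then have "g x \<in> N" "g x \<notin> C" "g x \<notin> g ` C"
      using g(2) by (auto simp: permutes_inverses)
    then show "x \<in> T" using gN by (auto simp: T_def N_def)
  qed
  moreover have "inj (inv g)" using gb(1) by (simp add: bij_imp_bij_inv bij_is_inj)
  ultimately have "infinite T"
    using g(4) by (meson finite_imageD finite_subset inj_on_subset subset_UNIV)
  \<comment> \<open>Half of \<open>T\<close> is kept back, because the target of \<open>L\<close>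
    must be co-infinite in \<open>M\<close> for \<sigma> to extend to a permutation of
    \<open>M\<close>.\<close>
  then obtain T1 where T1: "T1 \<subseteq> T" "infinite T1" "infinite (T - T1)"
    using infinite_split by blast
  have "infinite (g ` C)" using infC gb(2) by (meson finite_imageD inj_on_subset subset_UNIV)
  then have infL: "infinite L"
    using g(3) unfolding L_def by (metis Diff_Int2 Int_commute finite_Diff2 Diff_Int Un_Diff_Int finite_Un)
  have LM: "L \<subseteq> M" using gN by (auto simp: L_def N_def)
  have "N - (C \<union> g ` C) \<subseteq> M - L" by (auto simp: N_def L_def)
  then have MmL: "infinite (M - L)" using g(4) finite_subset by blast
  have "T - T1 \<subseteq> M - T1" by (auto simp: T_def)
  then have MmT: "infinite (M - T1)" using T1(3) finite_subset by blast
  obtain f where f: "bij_betw f L T1" using ex_bij_betw_infinite infL T1(2) by blast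
  obtain \<sigma> where \<sigma>: "\<sigma> permutes M" "\<And>x. x \<in> L \<Longrightarrow> \<sigma> x = f x"
    using ex_permutes_extending[OF f LM _ MmL MmT] T1(1) unfolding T_def by blast
  have \<sigma>T: "\<sigma> x \<in> T" if "x \<in> L" for x
    using that \<sigma>(2) f T1(1) by (auto simp: bij_betw_def)
  have infCK: "infinite (C - K1)" using infC K1 by simp
  \<comment> \<open>The exceptional points \<open>F1\<close> are sent into \<open>C - K1\<close>,
    from which the second application of \<open>g\<close> takes them into \<open>M\<close>.\<close>
  obtain K2 where K2: "K2 \<subseteq> C - K1" "finite K2" "card K2 = card F1"
    using infinite_arbitrarily_large[OF infCK, of "card F1"] by blast
  have "finite F1" using g(3) by (simp add: F1_def)
  then obtain e where e: "bij_betw e F1 K2"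
    using K2 finite_same_card_bij by metis
  obtain b where b: "b permutes C" "\<And>x. x \<in> F1 \<Longrightarrow> b x = e x"
    using ex_permutes_extending[OF e, of C] K2 infC \<open>finite F1\<close>
    by (metis Diff_subset F1_def Int_lower1 finite_Diff2 subset_trans)
  have bQ: "b permutes Q" "\<And>x. x \<in> F \<Longrightarrow> b x = x"
    using b(1) permutes_subset[of b C Q] permutes_not_in[OF b(1)] by (auto simp: C_def)
  obtain h where h: "h \<in> quotients S" "\<And>x. x \<in> M \<Longrightarrow> h x = \<sigma> x" "\<And>x. x \<in> F \<union> F1 \<Longrightarrow> h x = b x"
  proof -
    have "F1 \<subseteq> Q" by (auto simp: F1_def C_def)
    then show thesis using near[OF \<sigma>(1) bQ \<open>finite F1\<close>] that by blast
  qed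
  have hb: "bij h" using quotients_bij(1)[OF bij h(1)] .
  define y where "y = g \<circ> h \<circ> g"
  have yb: "bij y" unfolding y_def using gb(1) hb by (intro bij_comp)
  have yF: "y x = x" if "x \<in> F" for x
  proof -
    have "x \<notin> N" using that F(2) MQ by (auto simp: N_def C_def)
    then have "g x = x" using g(2) by (simp add: permutes_not_in)
    then show ?thesis using that h(3) bQ(2) by (simp add: y_def)
  qed
  have yC: "y c \<in> M" if c: "c \<in> C" for c
  proof (cases "g c \<in> C")
    case True
    then have F1: "g c \<in> F1" using c by (auto simp: F1_def)
    then have "h (g c) = e (g c)" using h(3) b(2) by simp
    then have *: "h (g c) \<in> C - K1" using F1 e K2(1) by (auto simp: bij_betw_def)
    then have "g (h (g c)) \<in> N" using gN by (simp add: N_def)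
    moreover have "g (h (g c)) \<notin> C" using * by (auto simp: K1_def)
    ultimately show ?thesis by (simp add: y_def N_def)
  next
    case False
    then have "g c \<in> L" using c by (auto simp: L_def)
    then show ?thesis using h(2) LM \<sigma>T by (auto simp: y_def T_def)
  qed
  have "inv y = inv g \<circ> inv h \<circ> inv g"
    using gb(1) hb by (simp add: y_def o_inv_distrib bij_comp o_assoc)
  then have iy: "inv g (inv h (inv g x)) = inv y x" for x by simp
  show thesis
  proof (rule that[OF F(1,2)])
    fix q assume q: "q permutes (Q - F)"
    then have qC: "q permutes C" by (simp add: C_def)
    \<comment> \<open>Conjugation by \<open>y\<close> moves the support of \<open>q\<close> into
      \<open>M\<close>, where a quotient can be prescribed completely and not just at finitely many
      points.\<close>
    define \<tau> where "\<tau> = y \<circ> q \<circ> inv y"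
    have "\<tau> permutes M"
      using permutes_subset[OF permutes_conj[OF yb qC]] yC unfolding \<tau>_def by blast
    then obtain k where k: "k \<in> quotients S" "\<And>x. x \<in> M \<Longrightarrow> k x = \<tau> x" "\<And>x. x \<in> F \<Longrightarrow> k x = x"
      using near[of \<tau> id "{}"] permutes_id by auto
    have "inv y (k (y c)) = q c" if "c \<in> Q" for c
    proof (cases "c \<in> F")
      case True
      then show ?thesis using yF k(3) q yb by (metis DiffD2 bij_inv_eq_iff permutes_not_in)
    next
      case False
      then have "k (y c) = y (q c)" using that k(2) yC yb by (simp add: C_def \<tau>_def bij_is_inj)
      then show ?thesis using yb by (simp add: bij_is_inj)
    qed
    then show "\<exists>g\<in>quotients S. \<exists>h\<in>quotients S. \<exists>k\<in>quotients S.
        inv g \<in> quotients S \<and> inv h \<in> quotients S \<and>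
        (\<forall>c\<in>Q. inv g (inv h (inv g (k (g (h (g c)))))) = q c)"
      using g(1) h(1) k(1) quotients_bij(2)[OF bij g(1)] quotients_bij(2)[OF bij h(1)]
      by (intro bexI[of _ g] bexI[of _ h] bexI[of _ k]) (simp_all add: iy, simp add: y_def)
  qed
qed

section \<open>Semigroup topologies on charts\<close>

lemma separable_metrizable_imp_second_countable:
  assumes "metrizable_space X" "separable_space X"
  shows "second_countable X"
proof -
  obtain M d where "Metric_space M d" and X: "X = Metric_space.mtopology M d"
    using assms(1) unfolding metrizable_space_def by blast
  then interpret Metric_space M d by simp
  obtain C where C: "countable C" "C \<subseteq> M" "mtopology closure_of C = M"
    using assms(2) unfolding X separable_space_def by auto
  define \<B> where "\<B> = (\<lambda>(c, n). mball c (1 / Suc n)) ` (C \<times> (UNIV :: nat set))"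
  show ?thesis
    unfolding second_countable_def
  proof (intro exI conjI allI impI)
    show "countable \<B>"
      unfolding \<B>_def using C(1) by auto
    show "\<forall>V\<in>\<B>. openin X V"
      unfolding \<B>_def X by auto
    fix U x assume "openin X U \<and> x \<in> U"
    then obtain r where r: "r > 0" "mball x r \<subseteq> U" and x: "x \<in> M"
      unfolding X openin_mtopology by blast
    obtain n where n: "1 / Suc n < r / 2"
      using reals_Archimedean[of "r / 2"] r(1) by (auto simp: inverse_eq_divide)
    have "x \<in> mtopology closure_of C" using x C(3) by simp
    then obtain c where c: "c \<in> C" "c \<in> mball x (1 / Suc n)"
      unfolding metric_closure_of by (auto dest!: spec[of _ "1 / Suc n"])
    then have cM: "c \<in> M" "d x c < 1 / Suc n" using C(2) by auto
    have "mball c (1 / Suc n) \<subseteq> mball x r"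
    proof
      fix y assume "y \<in> mball c (1 / Suc n)"
      then have y: "y \<in> M" "d c y < 1 / Suc n" by auto
      then have "d x y < r"
        using triangle[OF x cM(1) y(1)] cM(2) n by linarith
      then show "y \<in> mball x r" using x y by simp
    qed
    then show "\<exists>V\<in>\<B>. x \<in> V \<and> V \<subseteq> U"
      using c(1) cM x r(2) unfolding \<B>_def
      by (intro bexI[of _ "mball c (1 / Suc n)"]) (auto simp: commute)
  qed
qed

text \<open>Agreement of two charts on \<open>border n\<close> means that they, and their inverses, coincide as
  partial functions on \<open>{..<n}\<close>.\<close>

definition border :: "nat \<Rightarrow> (nat \<times> nat) set" where
  "border n = {(i, j). i < n \<or> j < n}"

abbreviation charts :: "(nat \<times> nat) set set" where
  "charts \<equiv> sym_inv_monoid UNIV"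

definition fgraph :: "('a \<Rightarrow> 'b) \<Rightarrow> ('a \<times> 'b) set" where
  "fgraph f = {(x, f x) | x. True}"

lemma fgraph_iff [simp]: "(x, y) \<in> fgraph f \<longleftrightarrow> y = f x"
  by (auto simp: fgraph_def)

lemma fgraph_relcomp: "fgraph f O fgraph g = fgraph (g \<circ> f)"
  by (auto simp: fgraph_def)

lemma fgraph_id: "fgraph id = Id"
  by (auto simp: fgraph_def)

lemma charts_iff: "R \<in> charts \<longleftrightarrow> single_valued R \<and> single_valued (R\<inverse>)"
  by (simp add: sym_inv_monoid_iff)

lemma charts_eqD:
  assumes "R \<in> charts" "(x, y) \<in> R"
  shows "(x, y') \<in> R \<Longrightarrow> y' = y" "(x', y) \<in> R \<Longrightarrow> x' = x"
  using assms unfolding charts_iff single_valued_def by blast+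

lemma chartsI:
  assumes "\<And>x y y'. (x, y) \<in> R \<Longrightarrow> (x, y') \<in> R \<Longrightarrow> y = y'"
    "\<And>x x' y. (x, y) \<in> R \<Longrightarrow> (x', y) \<in> R \<Longrightarrow> x = x'"
  shows "R \<in> charts"
  unfolding charts_iff single_valued_def using assms by blast

lemma charts_subset: "R \<in> charts \<Longrightarrow> S \<subseteq> R \<Longrightarrow> S \<in> charts"
  unfolding charts_iff single_valued_def by blast

lemma fgraph_charts: "inj p \<Longrightarrow> fgraph p \<in> charts"
  by (rule chartsI) (auto dest: injD)

lemma Id_charts: "Id \<in> charts"
  by (rule chartsI) auto

lemma single_chart: "{p} \<in> charts"
  by (rule chartsI) auto

lemma Id_on_charts: "Id_on A \<in> charts"
  by (rule chartsI) auto

lemma converse_charts: "R \<in> charts \<Longrightarrow> R\<inverse> \<in> charts"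
  by (simp add: charts_iff)

lemmas relcomp_charts = relcomp_in_sym_inv_monoid[where X = UNIV]

lemma finite_border_chart:
  assumes "f \<in> charts"
  shows "finite (f \<inter> border n)"
proof -
  have "finite {p \<in> f. fst p < n}"
  proof (rule inj_on_finite[of fst _ "{..<n}"])
    show "inj_on fst {p \<in> f. fst p < n}"
      using charts_eqD[OF assms] by (auto simp: inj_on_def)
  qed auto
  moreover have "finite {p \<in> f. snd p < n}"
  proof (rule inj_on_finite[of snd _ "{..<n}"])
    show "inj_on snd {p \<in> f. snd p < n}"
      using charts_eqD[OF assms] by (auto simp: inj_on_def)
  qed auto
  moreover have "f \<inter> border n \<subseteq> {p \<in> f. fst p < n} \<union> {p \<in> f. snd p < n}"
    by (auto simp: border_def)
  ultimately show ?thesis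
    by (meson finite_UnI finite_subset)
qed

text \<open>Second countability yields the countable cover of the permutations by classes. The T1
  axiom makes it an open condition to differ from a given chart, which turns products with only two
  possible values into clopen conditions.\<close>

locale chart_semigroup_topology =
  fixes T :: "(nat \<times> nat) set topology"
  assumes topspace: "topspace T = charts"
    and continuous_mult: "continuous_map (prod_topology T T) T (\<lambda>(x, y). x O y)"
    and second_countable: "second_countable T"
    and t1: "t1_space T"
begin

section \<open>Neighbourhoods and continuous multiplication\<close>

lemma open_charts: "openin T U \<Longrightarrow> x \<in> U \<Longrightarrow> x \<in> charts"
  using topspace openin_subset by blast

lemma mult_nbhds:
  assumes "openin T U" "x \<in> charts" "y \<in> charts" "x O y \<in> U"
  shows "\<exists>V W. openin T V \<and> openin T W \<and> x \<in> V \<and> y \<in> W \<and> (\<forall>v\<in>V. \<forall>w\<in>W. v O w \<in> U)"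
proof -
  let ?P = "{p \<in> topspace (prod_topology T T). (case p of (x, y) \<Rightarrow> x O y) \<in> U}"
  have "openin (prod_topology T T) ?P"
    using openin_continuous_map_preimage[OF continuous_mult assms(1)] .
  moreover have "(x, y) \<in> ?P"
    using assms topspace by simp
  ultimately have "\<exists>V W. openin T V \<and> openin T W \<and> x \<in> V \<and> y \<in> W \<and> V \<times> W \<subseteq> ?P"
    using openin_prod_topology_alt[of T T ?P] by meson
  then show ?thesis
    by (elim ex_forward conj_forward) auto
qed

lemma mult3_nbhds:
  assumes "openin T U" "x \<in> charts" "y \<in> charts" "z \<in> charts" "x O y O z \<in> U"
  shows "\<exists>V W V'. openin T V \<and> openin T W \<and> openin T V' \<and> x \<in> V \<and> y \<in> W \<and> z \<in> V' \<and>
    (\<forall>u\<in>V. \<forall>v\<in>W. \<forall>w\<in>V'. u O v O w \<in> U)"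
proof -
  obtain V P where V: "openin T V" "openin T P" "x \<in> V" "y O z \<in> P" "\<forall>v\<in>V. \<forall>w\<in>P. v O w \<in> U"
    using mult_nbhds[OF assms(1,2) relcomp_charts[OF assms(3,4)] assms(5)] by blast
  obtain W V' where W: "openin T W" "openin T V'" "y \<in> W" "z \<in> V'" "\<forall>v\<in>W. \<forall>w\<in>V'. v O w \<in> P"
    using mult_nbhds[OF V(2) assms(3,4) V(4)] by blast
  show ?thesis
    by (intro exI[of _ V] exI[of _ W] exI[of _ V']) (use V W in auto)
qed

lemma open_preimage_mult:
  assumes "openin T U" "a \<in> charts" "b \<in> charts"
  shows "openin T {x \<in> charts. a O x O b \<in> U}"
proof (subst openin_subopen, safe)
  fix x assume x: "x \<in> charts" "a O x O b \<in> U"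
  obtain V W V' where "openin T V" "openin T W" "openin T V'" "a \<in> V" "x \<in> W" "b \<in> V'"
    "\<forall>u\<in>V. \<forall>v\<in>W. \<forall>w\<in>V'. u O v O w \<in> U"
    using mult3_nbhds[OF assms(1,2) x(1) assms(3) x(2)] by blast
  then show "\<exists>W. openin T W \<and> x \<in> W \<and> W \<subseteq> {x \<in> charts. a O x O b \<in> U}"
    using open_charts by (intro exI[of _ W]) blast
qed

lemma open_delete: "openin T (charts - {a})"
  using t1 topspace by (metis Diff_insert_absorb Diff_idemp openin_topspace t1_space_openin_delete_alt)

text \<open>Between the two idempotents only \<open>{}\<close> and \<open>{(x, y)}\<close> are
  possible, so deleting \<open>{}\<close> from the space isolates membership; deleting
  \<open>{(x, y)}\<close> isolates its negation.\<close>

lemma open_mem: "openin T {h \<in> charts. (x, y) \<in> h}"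
proof -
  have "{h \<in> charts. (x, y) \<in> h} = {h \<in> charts. {(x, x)} O h O {(y, y)} \<in> charts - {{}}}"
    by (auto intro!: relcomp_charts chartsI)
  then show ?thesis
    using open_preimage_mult[OF open_delete, of "{(x, x)}" "{(y, y)}" "{}"] single_chart by simp
qed

lemma open_not_mem: "openin T {h \<in> charts. (x, y) \<notin> h}"
proof -
  have "{h \<in> charts. (x, y) \<notin> h} = {h \<in> charts. {(x, x)} O h O {(y, y)} \<in> charts - {{(x, y)}}}"
    by (auto intro!: relcomp_charts chartsI)
  then show ?thesis
    using open_preimage_mult[OF open_delete, of "{(x, x)}" "{(y, y)}" "{(x, y)}"] single_chart by simp
qed

lemma open_finite_conditions:
  assumes "finite P" "finite N"
  shows "openin T {h \<in> charts. P \<subseteq> h \<and> N \<inter> h = {}}"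
proof -
  have "openin T {h \<in> charts. P \<subseteq> h}"
    using assms(1)
  proof induction
    case empty
    show ?case using openin_topspace[of T] by (simp add: topspace)
  next
    case (insert p P)
    have "{h \<in> charts. insert p P \<subseteq> h} = {h \<in> charts. (fst p, snd p) \<in> h} \<inter> {h \<in> charts. P \<subseteq> h}"
      by auto
    then show ?case using insert.IH open_mem by (simp only: openin_Int)
  qed
  moreover have "openin T {h \<in> charts. N \<inter> h = {}}"
    using assms(2)
  proof induction
    case empty
    show ?case using openin_topspace[of T] by (simp add: topspace)
  next
    case (insert p P)
    have "{h \<in> charts. insert p P \<inter> h = {}} = {h \<in> charts. (fst p, snd p) \<notin> h} \<inter> {h \<in> charts. P \<inter> h = {}}"
      by auto
    then show ?case using insert.IH open_not_mem by (simp only: openin_Int)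
  qed
  moreover have "{h \<in> charts. P \<subseteq> h \<and> N \<inter> h = {}} = {h \<in> charts. P \<subseteq> h} \<inter> {h \<in> charts. N \<inter> h = {}}"
    by auto
  ultimately show ?thesis by (simp only: openin_Int)
qed

lemma open_sqrt_nbhd:
  assumes "openin T U" "Id \<in> U"
  obtains V where "openin T V" "Id \<in> V" "\<And>v w. v \<in> V \<Longrightarrow> w \<in> V \<Longrightarrow> v O w \<in> U"
proof -
  obtain V W where "openin T V" "openin T W" "Id \<in> V" "Id \<in> W"
    "\<forall>v\<in>V. \<forall>w\<in>W. v O w \<in> U"
    using mult_nbhds[OF assms(1) Id_charts Id_charts] assms(2) by auto
  then show thesis by (intro that[of "V \<inter> W"]) auto
qed

text \<open>Substitute for continuity of inversion: since \<open>p\<close> times its inverse is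
  \<open>Id\<close>, there are basic open sets around \<open>fgraph p\<close> and
  \<open>fgraph (inv p)\<close> whose product lies in \<open>V\<close>. Only countably many pairs of
  basic sets exist, and each pair defines one class \<open>S n\<close>; for two members
  \<open>s\<close>, \<open>t\<close> of a class, \<open>fgraph t\<close> and
  \<open>fgraph (inv s)\<close> then multiply into \<open>V\<close>.\<close>

lemma countable_cover_bij:
  assumes "openin T V" "Id \<in> V"
  obtains S :: "nat \<Rightarrow> (nat \<Rightarrow> nat) set" where "\<And>p. bij p \<Longrightarrow> \<exists>n. p \<in> S n" "\<And>n. S n \<subseteq> Collect bij"
    "\<And>y. y \<in> quotients S \<Longrightarrow> fgraph y \<in> V"
proof -
  obtain \<B> where \<B>: "countable \<B>" "\<And>B. B \<in> \<B> \<Longrightarrow> openin T B"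
    "\<And>U x. openin T U \<and> x \<in> U \<longrightarrow> (\<exists>B\<in>\<B>. x \<in> B \<and> B \<subseteq> U)"
    using second_countable by (auto simp: second_countable_def)
  define \<C> where "\<C> = {(A, B) \<in> \<B> \<times> \<B>. \<forall>v\<in>A. \<forall>w\<in>B. v O w \<in> V}"
  have near: "\<exists>(A, B)\<in>\<C>. fgraph p \<in> A \<and> fgraph (inv p) \<in> B" if p: "bij p" for p
  proof -
    have *: "fgraph p \<in> charts" "fgraph (inv p) \<in> charts" "fgraph p O fgraph (inv p) \<in> V"
      using p assms(2) by (auto intro!: fgraph_charts simp: fgraph_relcomp bij_is_inj bij_imp_bij_inv fgraph_id)
    obtain A B where AB: "openin T A" "openin T B" "fgraph p \<in> A" "fgraph (inv p) \<in> B"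
      "\<forall>v\<in>A. \<forall>w\<in>B. v O w \<in> V"
      using mult_nbhds[OF assms(1) *] by blast
    obtain A' where "A' \<in> \<B>" "fgraph p \<in> A'" "A' \<subseteq> A" using \<B>(3)[of A "fgraph p"] AB by blast
    moreover obtain B' where "B' \<in> \<B>" "fgraph (inv p) \<in> B'" "B' \<subseteq> B" using \<B>(3)[of B "fgraph (inv p)"] AB by blast
    ultimately show ?thesis
      using AB(5) unfolding \<C>_def by (intro bexI[of _ "(A', B')"]) auto
  qed
  have "countable \<C>"
    by (rule countable_subset[of _ "\<B> \<times> \<B>"]) (use \<B>(1) in \<open>auto simp: \<C>_def\<close>)
  moreover have "\<C> \<noteq> {}" using near[of id] by auto
  ultimately have r: "range (from_nat_into \<C>) = \<C>" by (rule range_from_nat_into[rotated])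
  define S where "S n = {p. bij p \<and> fgraph p \<in> fst (from_nat_into \<C> n) \<and> fgraph (inv p) \<in> snd (from_nat_into \<C> n)}" for n
  show thesis
  proof
    show "\<exists>n. p \<in> S n" if "bij p" for p
    proof -
      obtain A B where AB: "(A, B) \<in> \<C>" "fgraph p \<in> A" "fgraph (inv p) \<in> B" using near[OF \<open>bij p\<close>] by blast
      then obtain n where "from_nat_into \<C> n = (A, B)" using r by (metis imageE)
      then show ?thesis using AB that by (intro exI[of _ n]) (simp add: S_def)
    qed
    show "S n \<subseteq> Collect bij" for n by (auto simp: S_def)
    fix y assume "y \<in> quotients S"
    then obtain s t n where y: "y = inv s \<circ> t" "s \<in> S n" "t \<in> S n" unfolding quotients_def by blast
    moreover have "from_nat_into \<C> n \<in> \<C>" using r by blast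
    ultimately have "fgraph t O fgraph (inv s) \<in> V" unfolding S_def \<C>_def by auto
    then show "fgraph y \<in> V" by (simp add: y fgraph_relcomp)
  qed
qed

end

section \<open>Automatic continuity\<close>

text \<open>A chart \<open>x\<close> becomes the restriction to the multiples of 3 of a permutation: the points
  \<open>3 i + 1\<close> absorb what is missing from its domain and range, and \<open>3 i + 2\<close> is never moved.\<close>

definition dilation :: "(nat \<times> nat) set \<Rightarrow> nat \<Rightarrow> nat" where
  "dilation x i =
    (if i mod 3 = 0 then if i div 3 \<in> Domain x then 3 * (THE j. (i div 3, j) \<in> x) else i + 1
     else if i mod 3 = 1 then if i div 3 \<in> Range x then 3 * (THE j. (j, i div 3) \<in> x) + 1 else i - 1
     else i)"

lemma dilation_simps:
  assumes "x \<in> charts"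
  shows "(i, j) \<in> x \<Longrightarrow> dilation x (3 * i) = 3 * j"
    "i \<notin> Domain x \<Longrightarrow> dilation x (3 * i) = 3 * i + 1"
    "(i, j) \<in> x \<Longrightarrow> dilation x (3 * j + 1) = 3 * i + 1"
    "j \<notin> Range x \<Longrightarrow> dilation x (3 * j + 1) = 3 * j"
    "dilation x (3 * i + 2) = 3 * i + 2"
proof -
  have arith: "(3 * k) div 3 = k" "(3 * k) mod 3 = 0" "(3 * k + 1) div 3 = k" "(3 * k + 1) mod 3 = 1"
    "(3 * k + 2) mod 3 = 2" for k :: nat
    by presburger+
  show "dilation x (3 * i) = 3 * j" if "(i, j) \<in> x"
  proof -
    have "(THE j'. (i, j') \<in> x) = j" using that charts_eqD[OF assms that] by blast
    then show ?thesis using that unfolding dilation_def arith by auto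
  qed
  show "dilation x (3 * j + 1) = 3 * i + 1" if "(i, j) \<in> x"
  proof -
    have "(THE i'. (i', j) \<in> x) = i" using that charts_eqD[OF assms that] by blast
    then show ?thesis using that unfolding dilation_def arith by auto
  qed
  show "dilation x (3 * i) = 3 * i + 1" if "i \<notin> Domain x"
    using that unfolding dilation_def arith by auto
  show "dilation x (3 * j + 1) = 3 * j" if "j \<notin> Range x"
    using that unfolding dilation_def arith by auto
  show "dilation x (3 * i + 2) = 3 * i + 2"
    unfolding dilation_def arith by auto
qed

lemma nat_mod3_cases:
  fixes i :: nat
  obtains k where "i = 3 * k" | k where "i = 3 * k + 1" | k where "i = 3 * k + 2"
proof -
  have "i = 3 * (i div 3) \<or> i = 3 * (i div 3) + 1 \<or> i = 3 * (i div 3) + 2" by presburger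
  then show thesis using that by blast
qed

lemma dilation_inverse:
  assumes "x \<in> charts"
  shows "dilation (x\<inverse>) (dilation x i) = i"
proof (cases i rule: nat_mod3_cases)
  case (1 k)
  then show ?thesis
    using dilation_simps[OF assms] dilation_simps[OF converse_charts[OF assms]]
    by (cases "k \<in> Domain x") auto
next
  case (2 k)
  then show ?thesis
    using dilation_simps[OF assms] dilation_simps[OF converse_charts[OF assms]]
    by (cases "k \<in> Range x") auto
next
  case (3 k)
  then show ?thesis
    using dilation_simps(5)[OF assms] dilation_simps(5)[OF converse_charts[OF assms]] by simp
qed

lemma dilation_permutes:
  assumes "x \<in> charts"
  shows "dilation x permutes {i. i mod 3 \<noteq> 2}"
proof -
  have "dilation x (dilation (x\<inverse>) i) = i" for i
    using dilation_inverse[OF converse_charts[OF assms]] by simp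
  then have "\<exists>!i. dilation x i = j" for j
    using dilation_inverse[OF assms] by (intro ex1I[of _ "dilation (x\<inverse>) j"]) auto
  then show ?thesis
    unfolding permutes_def by (auto simp: dilation_def)
qed

text \<open>The value at \<open>i\<close> is decided by row and column \<open>i div 3\<close> of the
  chart, and \<open>border n\<close> is the union of the rows and columns below
  \<open>n\<close>.\<close>

lemma dilation_cong:
  assumes "x \<inter> border n = s \<inter> border n" "i div 3 < n"
  shows "dilation x i = dilation s i"
proof -
  have "(i div 3, j) \<in> x \<longleftrightarrow> (i div 3, j) \<in> s" "(j, i div 3) \<in> x \<longleftrightarrow> (j, i div 3) \<in> s" for j
    using assms by (auto simp: border_def)
  then have "(\<lambda>j. (i div 3, j) \<in> x) = (\<lambda>j. (i div 3, j) \<in> s)"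
    "(\<lambda>j. (j, i div 3) \<in> x) = (\<lambda>j. (j, i div 3) \<in> s)"
    "i div 3 \<in> Domain x \<longleftrightarrow> i div 3 \<in> Domain s" "i div 3 \<in> Range x \<longleftrightarrow> i div 3 \<in> Range s"
    by auto
  then show ?thesis by (simp only: dilation_def)
qed

text \<open>The injection enters at the multiples of 3 and its converse discards all other values; a
  point missing from \<open>Domain x\<close> is sent to \<open>3 * i + 1\<close> and so drops
  out.\<close>

lemma dilation_compress:
  assumes "x \<in> charts"
  shows "fgraph (\<lambda>i. 3 * i) O fgraph (dilation x) O (fgraph (\<lambda>i. 3 * i))\<inverse> = x"
proof -
  have "3 * j = dilation x (3 * i) \<longleftrightarrow> (i, j) \<in> x" for i j
  proof (cases "i \<in> Domain x")
    case True
    then obtain k where "(i, k) \<in> x" by blast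
    then show ?thesis
      using dilation_simps(1)[OF assms] charts_eqD(1)[OF assms] by auto
  next
    case False
    then have "3 * j \<noteq> dilation x (3 * i)"
      using dilation_simps(2)[OF assms False] by presburger
    with False show ?thesis by blast
  qed
  then have "dilation x (3 * i) = 3 * j \<longleftrightarrow> (i, j) \<in> x" for i j
    by metis
  then show ?thesis by (simp add: set_eq_iff relcomp_unfold)
qed

lemma infinite_mod3: "infinite {i::nat. i mod 3 \<noteq> 2}" "infinite (- {i::nat. i mod 3 \<noteq> 2})"
proof -
  have "infinite (range (\<lambda>i::nat. 3 * i))" "infinite (range (\<lambda>i::nat. 3 * i + 2))"
    by (rule range_inj_infinite, simp add: inj_def)+
  moreover have "range (\<lambda>i::nat. 3 * i) \<subseteq> {i. i mod 3 \<noteq> 2}"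
    "range (\<lambda>i::nat. 3 * i + 2) \<subseteq> - {i. i mod 3 \<noteq> 2}"
   
    by (auto, presburger)
  ultimately show "infinite {i::nat. i mod 3 \<noteq> 2}" "infinite (- {i::nat. i mod 3 \<noteq> 2})"
    using finite_subset by blast+
qed

text \<open>Both \<open>s\<close> and \<open>x\<close> are compressions of permutations, and
  \<open>q\<close> turns \<open>dilation s\<close> into \<open>dilation x\<close>. When
  \<open>x\<close> agrees with \<open>s\<close> far enough, \<open>q\<close> fixes the finite set
  \<open>F\<close> and is therefore, on \<open>?Q\<close>, a product of seven quotients close to
  \<open>Id\<close>; inserting that product into the factorization of \<open>s\<close> gives
  \<open>x\<close>.\<close>

lemma (in chart_semigroup_topology) open_contains_border_class:
  assumes U: "openin T U" "s \<in> U"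
  obtains n where "\<And>x. x \<in> charts \<Longrightarrow> x \<inter> border n = s \<inter> border n \<Longrightarrow> x \<in> U"
proof -
  let ?f = "fgraph (\<lambda>i::nat. 3 * i)"
  \<comment> \<open>The points \<open>3 * i + 2\<close> outside \<open>?Q\<close> give the quotients
    room to act. The product \<open>z\<close> is controlled only on \<open>?Q\<close>, which
    suffices because the range of \<open>a\<close> lies there.\<close>
  let ?Q = "{i::nat. i mod 3 \<noteq> 2}"
  have s: "s \<in> charts" using U open_charts by blast
  have f: "?f \<in> charts" "?f\<inverse> \<in> charts"
    by (auto intro!: fgraph_charts converse_charts simp: inj_def)
  have dil: "fgraph (dilation x) \<in> charts" if "x \<in> charts" for x
    using dilation_permutes[OF that] by (intro fgraph_charts permutes_inj)
  define a where "a = ?f O fgraph (dilation s)"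
  have a: "a \<in> charts" unfolding a_def using f dil[OF s] by (intro relcomp_charts)
  define V where "V = {z \<in> charts. a O z O ?f\<inverse> \<in> U}"
  have V: "openin T V" unfolding V_def by (rule open_preimage_mult[OF U(1) a f(2)])
  have "Id \<in> V"
    unfolding V_def a_def using U(2) dilation_compress[OF s] by (simp add: Id_charts O_assoc)
  \<comment> \<open>Three halvings admit products of eight factors: the seven quotients, with
    \<open>Id\<close> filling the last place of \<open>z\<close>.\<close>
  then obtain V1 where V1: "openin T V1" "Id \<in> V1" "\<And>v w. v \<in> V1 \<Longrightarrow> w \<in> V1 \<Longrightarrow> v O w \<in> V"
    using open_sqrt_nbhd[OF V] by blast
  then obtain V2 where V2: "openin T V2" "Id \<in> V2" "\<And>v w. v \<in> V2 \<Longrightarrow> w \<in> V2 \<Longrightarrow> v O w \<in> V1"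
    using open_sqrt_nbhd[OF V1(1,2)] by blast
  then obtain V3 where V3: "openin T V3" "Id \<in> V3" "\<And>v w. v \<in> V3 \<Longrightarrow> w \<in> V3 \<Longrightarrow> v O w \<in> V2"
    using open_sqrt_nbhd[OF V2(1,2)] by blast
  obtain S :: "nat \<Rightarrow> (nat \<Rightarrow> nat) set" where S: "\<And>p. bij p \<Longrightarrow> \<exists>n. p \<in> S n" "\<And>n. S n \<subseteq> Collect bij"
    "\<And>y. y \<in> quotients S \<Longrightarrow> fgraph y \<in> V3"
    using countable_cover_bij[OF V3(1,2)] by blast
  obtain F where F: "finite F" "F \<subseteq> ?Q" and
    ext: "\<And>q. q permutes (?Q - F) \<Longrightarrow> \<exists>g\<in>quotients S. \<exists>h\<in>quotients S. \<exists>k\<in>quotients S.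
        inv g \<in> quotients S \<and> inv h \<in> quotients S \<and>
        (\<forall>c\<in>?Q. inv g (inv h (inv g (k (g (h (g c)))))) = q c)"
    using quotients_extend_near_identity[OF S(1,2) infinite_mod3] by metis
  \<comment> \<open>Chosen so that \<open>dilation x\<close> and \<open>dilation s\<close> agree at
    the points \<open>dilation (s\<inverse>) c\<close> for \<open>c\<close> in \<open>F\<close>,
    which makes \<open>q\<close> fix \<open>F\<close>. The inserted \<open>0\<close> covers the case
    of empty \<open>F\<close>.\<close>
  define n where "n = Suc (Max (insert 0 ((\<lambda>c. dilation (s\<inverse>) c div 3) ` F)))"
  have n: "dilation (s\<inverse>) c div 3 < n" if "c \<in> F" for c
    unfolding n_def using that F(1) by (simp add: less_Suc_eq_le)
  show thesis
  proof
    fix x assume x: "x \<in> charts" "x \<inter> border n = s \<inter> border n"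
    define q where "q = dilation x \<circ> dilation (s\<inverse>)"
    have qs: "q (dilation s i) = dilation x i" for i
      by (simp add: q_def dilation_inverse[OF s])
    have "q permutes ?Q"
      unfolding q_def using dilation_permutes x(1) converse_charts[OF s] by (intro permutes_compose)
    moreover have "q c = c" if "c \<in> F" for c
      using dilation_cong[OF x(2) n[OF that]] dilation_inverse[OF converse_charts[OF s]]
      by (simp add: q_def)
    ultimately have "q permutes (?Q - F)"
      by (auto intro: permutes_superset)
    then obtain g h k where g: "g \<in> quotients S" "h \<in> quotients S" "k \<in> quotients S"
        "inv g \<in> quotients S" "inv h \<in> quotients S"
      and q: "\<And>c. c \<in> ?Q \<Longrightarrow> inv g (inv h (inv g (k (g (h (g c)))))) = q c"
      using ext[of q] by blast
    define z where "z = ((fgraph g O fgraph h) O (fgraph g O fgraph k)) O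
      ((fgraph (inv g) O fgraph (inv h)) O (fgraph (inv g) O Id))"
    have "z \<in> V"
      unfolding z_def using g S(3) V1 V2 V3 by (intro V1(3) V2(3) V3(3)) auto
    then have "a O z O ?f\<inverse> \<in> U" by (simp add: V_def)
    moreover have z: "z = fgraph (inv g \<circ> inv h \<circ> inv g \<circ> k \<circ> g \<circ> h \<circ> g)"
      by (simp add: z_def fgraph_relcomp o_assoc)
    have "dilation s (3 * i) \<in> ?Q" for i
    proof -
      have "3 * i \<in> ?Q" by simp
      then show ?thesis using dilation_permutes[OF s] by (simp only: permutes_in_image)
    qed
    then have "inv g \<circ> inv h \<circ> inv g \<circ> k \<circ> g \<circ> h \<circ> g \<circ> (dilation s \<circ> (\<lambda>i. 3 * i)) = dilation x \<circ> (\<lambda>i. 3 * i)"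
      by (simp only: fun_eq_iff o_apply q qs simp_thms)
    then have "a O z = ?f O fgraph (dilation x)"
      by (simp only: a_def z fgraph_relcomp)
    then have "a O z O ?f\<inverse> = x"
      using dilation_compress[OF x(1)] by (metis O_assoc)
    ultimately show "x \<in> U" by simp
  qed
qed

section \<open>Determination by closures of spanning sets\<close>

text \<open>An injection \<tau> from the pairs of \<open>f'\<close> to those of \<open>h\<close>
  that preserves every coordinate below \<open>n\<close> gives both factors: \<open>u\<close> sends
  first coordinates of \<open>p\<close> to those of \<open>\<tau> p\<close>, and \<open>v\<close>
  brings second coordinates back. A pair with a coordinate below \<open>n\<close> has a forced
  image, which exists by \<open>dom\<close> and \<open>ran\<close>; the remaining pairs go to the
  part of \<open>h\<close> outside \<open>border n\<close>, which is infinite because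
  \<open>h\<close> is.\<close>

lemma chart_factorization:
  assumes ch: "f \<in> charts" "f' \<in> charts" "h \<in> charts" and inf: "infinite h"
    and fh: "f \<inter> border n \<subseteq> h" "h \<inter> {..<n} \<times> {..<n} \<subseteq> f"
    and ff': "f \<inter> border n \<subseteq> f'" "f' \<inter> {..<n} \<times> {..<n} \<subseteq> f"
    and dom: "Domain f' \<inter> {..<n} \<subseteq> Domain h" and ran: "Range f' \<inter> {..<n} \<subseteq> Range h"
  obtains u v where "u \<in> charts" "v \<in> charts" "u \<inter> border n = Id \<inter> border n"
    "v \<inter> border n = Id \<inter> border n" "u O h O v = f'"
proof -
  define far where "far = h - border n"
  have "finite (h \<inter> border n)" using ch(3) by (rule finite_border_chart)
  then have inf_far: "infinite far" using inf unfolding far_def by (metis Int_Diff_Un finite_Un)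
  define e where "e = from_nat_into far \<circ> (to_nat_on f' :: nat \<times> nat \<Rightarrow> nat)"
  have b: "bij_betw (from_nat_into far) UNIV far"
    using inf_far by (simp add: bij_betw_from_nat_into)
  have einj: "inj_on e f'"
    unfolding e_def
    by (rule comp_inj_on) (use b in \<open>auto simp: bij_betw_def intro: inj_on_subset\<close>)
  have efar: "e p \<in> far" for p
    unfolding e_def using b by (auto simp: bij_betw_def)
  have "\<forall>p\<in>f'. \<exists>q. q \<in> h \<and> (fst p < n \<or> fst q < n \<longrightarrow> fst q = fst p) \<and>
    (snd p < n \<or> snd q < n \<longrightarrow> snd q = snd p) \<and> (n \<le> fst p \<and> n \<le> snd p \<longrightarrow> q = e p)"
  proof
    fix p assume p: "p \<in> f'"
    obtain x y where pe: "p = (x, y)" by fastforce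
    consider "x < n" | "n \<le> x" "y < n" | "n \<le> x" "n \<le> y" by linarith
    then show "\<exists>q. q \<in> h \<and> (fst p < n \<or> fst q < n \<longrightarrow> fst q = fst p) \<and>
      (snd p < n \<or> snd q < n \<longrightarrow> snd q = snd p) \<and> (n \<le> fst p \<and> n \<le> snd p \<longrightarrow> q = e p)"
    proof cases
      case 1
      then obtain w where w: "(x, w) \<in> h" using dom p pe by blast
      have "w = y" if "y < n"
      proof -
        have "(x, y) \<in> h" using that 1 p pe ff'(2) fh(1) by (auto simp: border_def)
        then show ?thesis using charts_eqD(1)[OF ch(3)] w by blast
      qed
      moreover have "w = y" if "w < n"
      proof -
        have "(x, w) \<in> f'" using that 1 w ff'(1) fh(2) by (auto simp: border_def)
        then show ?thesis using charts_eqD(1)[OF ch(2)] p pe by blast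
      qed
      ultimately have *: "y < n \<or> w < n \<Longrightarrow> w = y" by blast
      show ?thesis
      proof (intro exI[of _ "(x, w)"] conjI impI)
        show "(x, w) \<in> h" by (rule w)
        show "fst (x, w) = fst p" by (simp add: pe)
        show "snd (x, w) = snd p" if "snd p < n \<or> snd (x, w) < n"
          using *[OF that[unfolded pe snd_conv]] by (simp only: pe snd_conv)
        show "(x, w) = e p" if "n \<le> fst p \<and> n \<le> snd p"
          using that 1 by (simp add: pe)
      qed
    next
      case 2
      then obtain z where z: "(z, y) \<in> h" using ran p pe by blast
      have "z = x" if "z < n"
      proof -
        have "(z, y) \<in> f'" using that 2 z ff'(1) fh(2) by (auto simp: border_def)
        then show ?thesis using charts_eqD(2)[OF ch(2)] p pe by blast
      qed
      then have *: "x < n \<or> z < n \<Longrightarrow> z = x" using 2(1) by linarith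
      show ?thesis
      proof (intro exI[of _ "(z, y)"] conjI impI)
        show "(z, y) \<in> h" by (rule z)
        show "snd (z, y) = snd p" by (simp add: pe)
        show "fst (z, y) = fst p" if "fst p < n \<or> fst (z, y) < n"
          using *[OF that[unfolded pe fst_conv]] by (simp only: pe fst_conv)
        show "(z, y) = e p" if "n \<le> fst p \<and> n \<le> snd p"
          using that 2 by (simp add: pe)
      qed
    next
      case 3
      then show ?thesis using efar[of p] pe
        by (intro exI[of _ "e p"]) (auto simp: far_def border_def split: prod.splits)
    qed
  qed
  then obtain \<tau> where \<tau>: "\<And>p. p \<in> f' \<Longrightarrow> \<tau> p \<in> h"
    "\<And>p. p \<in> f' \<Longrightarrow> fst p < n \<or> fst (\<tau> p) < n \<Longrightarrow> fst (\<tau> p) = fst p"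
    "\<And>p. p \<in> f' \<Longrightarrow> snd p < n \<or> snd (\<tau> p) < n \<Longrightarrow> snd (\<tau> p) = snd p"
    "\<And>p. p \<in> f' \<Longrightarrow> n \<le> fst p \<Longrightarrow> n \<le> snd p \<Longrightarrow> \<tau> p = e p"
    by (drule_tac bchoice) blast
  have fst_inj: "p = p'" if "p \<in> g" "p' \<in> g" "fst p = fst p'" "g \<in> charts" for p p' g
    using that charts_eqD(1)[of g "fst p"] by (metis prod.collapse)
  have snd_inj: "p = p'" if "p \<in> g" "p' \<in> g" "snd p = snd p'" "g \<in> charts" for p p' g
    using that charts_eqD(2)[of g _ "snd p"] by (metis prod.collapse)
  have \<tau>inj: "p = p'" if p: "p \<in> f'" "p' \<in> f'" "\<tau> p = \<tau> p'" for p p'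
  proof (cases "fst (\<tau> p) < n \<or> snd (\<tau> p) < n")
    case True
    then show ?thesis
      using \<tau>(2,3) p fst_inj[OF p(1,2) _ ch(2)] snd_inj[OF p(1,2) _ ch(2)] by metis
  next
    case False
    then have "n \<le> fst p" "n \<le> snd p" "n \<le> fst p'" "n \<le> snd p'"
      using \<tau>(2,3)[OF p(1)] \<tau>(2,3)[OF p(2)] p(3) by (metis not_less)+
    then show ?thesis using \<tau>(4) p einj by (metis inj_onD)
  qed
  \<comment> \<open>The diagonal below \<open>n\<close> is included even outside
    \<open>Domain f'\<close>, so that \<open>u\<close> agrees with \<open>Id\<close> on
    \<open>border n\<close>. A pair of \<open>h\<close> starting at such an extra point neither ends
    below \<open>n\<close> nor lies in the image of \<tau>, so \<open>v\<close> discards it.\<close>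
  define u where "u = {(i, i) | i. i < n} \<union> {(fst p, fst (\<tau> p)) | p. p \<in> f'}"
  define v where "v = {(j, j) | j. j < n} \<union> {(snd (\<tau> p), snd p) | p. p \<in> f'}"
  have u_iff: "(x, z) \<in> u \<longleftrightarrow> (x < n \<and> z = x) \<or> (\<exists>p\<in>f'. x = fst p \<and> z = fst (\<tau> p))" for x z
    unfolding u_def by blast
  have v_iff: "(w, y) \<in> v \<longleftrightarrow> (y < n \<and> w = y) \<or> (\<exists>p\<in>f'. w = snd (\<tau> p) \<and> y = snd p)" for w y
    unfolding v_def by blast
  have "u \<in> charts"
  proof (rule chartsI)
    fix x z z' assume "(x, z) \<in> u" "(x, z') \<in> u"
    then show "z = z'"
      unfolding u_iff using \<tau>(2) fst_inj[OF _ _ _ ch(2)] by metis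
  next
    fix x x' z assume "(x, z) \<in> u" "(x', z) \<in> u"
    then show "x = x'"
      unfolding u_iff using \<tau>(1,2) \<tau>inj fst_inj[OF _ _ _ ch(3)] by metis
  qed
  moreover have "v \<in> charts"
  proof (rule chartsI)
    fix w y y' assume "(w, y) \<in> v" "(w, y') \<in> v"
    then show "y = y'"
      unfolding v_iff using \<tau>(1,3) \<tau>inj snd_inj[OF _ _ _ ch(3)] by metis
  next
    fix w w' y assume "(w, y) \<in> v" "(w', y) \<in> v"
    then show "w = w'"
      unfolding v_iff using \<tau>(3) snd_inj[OF _ _ _ ch(2)] by metis
  qed
  moreover have "u \<inter> border n = Id \<inter> border n"
    using \<tau>(2) by (auto simp: u_iff border_def) metis+
  moreover have "v \<inter> border n = Id \<inter> border n"
    using \<tau>(3) by (auto simp: v_iff border_def)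
  moreover have "u O h O v = f'"
  proof
    show "f' \<subseteq> u O h O v"
    proof
      fix p assume p: "p \<in> f'"
      have "(fst p, fst (\<tau> p)) \<in> u" "(fst (\<tau> p), snd (\<tau> p)) \<in> h" "(snd (\<tau> p), snd p) \<in> v"
        using p \<tau>(1)[OF p] by (auto simp: u_iff v_iff)
      then have "(fst p, snd p) \<in> u O h O v" by blast
      then show "p \<in> u O h O v" by simp
    qed
    show "u O h O v \<subseteq> f'"
    proof
      fix r assume "r \<in> u O h O v"
      then obtain x z w y where r: "r = (x, y)" and xz: "(x, z) \<in> u" and zw: "(z, w) \<in> h" and wy: "(w, y) \<in> v"
        by blast
      consider p where "p \<in> f'" "x = fst p" "z = fst (\<tau> p)" | "x < n" "z = x" "x \<notin> Domain f'"
        using xz \<tau>(2) unfolding u_iff by (metis Domain.cases fst_conv)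
      then have "(x, y) \<in> f'"
      proof cases
        case 1
        then have w: "w = snd (\<tau> p)"
          using zw \<tau>(1)[OF 1(1)] charts_eqD(1)[OF ch(3)] by (metis prod.collapse)
        have "y = snd p"
          using wy unfolding v_iff
        proof
          assume "y < n \<and> w = y"
          then show ?thesis using \<tau>(3)[OF 1(1)] w by simp
        next
          assume "\<exists>p\<in>f'. w = snd (\<tau> p) \<and> y = snd p"
          then obtain p' where p': "p' \<in> f'" "w = snd (\<tau> p')" "y = snd p'" by blast
          then have "\<tau> p' = \<tau> p" using w snd_inj[OF \<tau>(1) \<tau>(1) _ ch(3)] 1(1) by metis
          then show ?thesis using \<tau>inj p' 1(1) by metis
        qed
        then show ?thesis using 1 by simp
      next
        case 2
        show ?thesis
          using wy unfolding v_iff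
        proof
          assume "y < n \<and> w = y"
          then show ?thesis using 2 zw fh(2) ff'(1) by (auto simp: border_def)
        next
          assume "\<exists>p\<in>f'. w = snd (\<tau> p) \<and> y = snd p"
          then obtain p' where p': "p' \<in> f'" "w = snd (\<tau> p')" "y = snd p'" by blast
          then have "\<tau> p' = (z, w)" using zw snd_inj[OF \<tau>(1) zw _ ch(3)] by simp
          then have "fst p' = x" using 2 \<tau>(2)[OF p'(1)] by simp
          then show ?thesis using 2(3) p'(1) by (metis Domain.DomainI prod.collapse)
        qed
      qed
      then show "r \<in> f'" by (simp add: r)
    qed
  qed
  ultimately show thesis by (rule that)
qed

definition spanning :: "nat set \<Rightarrow> nat set \<Rightarrow> (nat \<times> nat) set set" where
  "spanning A B = {h \<in> charts. A \<subseteq> Domain h \<and> B \<subseteq> Range h}"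

context chart_semigroup_topology
begin

lemma in_closure_iff:
  "f \<in> T closure_of S \<longleftrightarrow> f \<in> charts \<and> (\<forall>V. openin T V \<and> f \<in> V \<longrightarrow> (\<exists>h\<in>S. h \<in> V))"
  by (auto simp: in_closure_of topspace)

text \<open>Adding the diagonal beyond all points of a finite \<open>h\<close> changes nothing on
  \<open>border n\<close>. This supplies the infinite chart that \<open>chart_factorization\<close>
  demands.\<close>

lemma open_contains_infinite:
  assumes "openin T V" "h \<in> V"
  obtains h' where "h' \<in> V" "h \<subseteq> h'" "infinite h'"
proof (cases "finite h")
  case False
  then show ?thesis using that assms by blast
next
  case True
  have h: "h \<in> charts" using assms open_charts by blast
  obtain n where n: "\<And>x. x \<in> charts \<Longrightarrow> x \<inter> border n = h \<inter> border n \<Longrightarrow> x \<in> V"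
    using open_contains_border_class[OF assms] by blast
  define m where "m = Suc (Max (insert n (Domain h \<union> Range h)))"
  have "finite (insert n (Domain h \<union> Range h))" using True by (simp add: finite_Domain finite_Range)
  then have m: "i < m" if "i \<in> insert n (Domain h \<union> Range h)" for i
    unfolding m_def using that by (simp only: less_Suc_eq_le Max_ge)
  have hm: "x < m" "y < m" if "(x, y) \<in> h" for x y using m that by blast+
  define h' where "h' = h \<union> Id_on {m..}"
  have h'_iff: "(x, y) \<in> h' \<longleftrightarrow> (x, y) \<in> h \<or> (m \<le> x \<and> y = x)" for x y
    by (auto simp: h'_def)
  have "h' \<in> charts"
  proof (rule chartsI)
    show "y = y'" if "(x, y) \<in> h'" "(x, y') \<in> h'" for x y y'
      using that hm charts_eqD(1)[OF h] unfolding h'_iff by (meson not_less)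
    show "x = x'" if "(x, y) \<in> h'" "(x', y) \<in> h'" for x x' y
      using that hm charts_eqD(2)[OF h] unfolding h'_iff by (metis not_less)
  qed
  moreover have "h' \<inter> border n = h \<inter> border n"
    using m[of n] by (auto simp: h'_def border_def)
  ultimately have "h' \<in> V" by (rule n)
  moreover have "infinite h'"
  proof
    assume "finite h'"
    then have "finite (Domain (Id_on {m..}))" unfolding h'_def by (metis finite_Domain finite_Un)
    then show False by (simp add: infinite_Ici)
  qed
  ultimately show ?thesis using that by (auto simp: h'_def)
qed

text \<open>A chart \<open>f'\<close> that looks like \<open>f\<close> up to escaping points is a product \<open>u O h O v\<close> with \<open>u\<close>, \<open>v\<close>
  near \<open>Id\<close> and \<open>h\<close> near \<open>f\<close> having the same escaping points.\<close>

lemma open_contains_closure_class: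
  assumes U: "openin T U" "f \<in> U"
  obtains n where "\<And>f'. f' \<in> charts \<Longrightarrow> f \<inter> border n \<subseteq> f' \<Longrightarrow> f' \<inter> {..<n} \<times> {..<n} \<subseteq> f \<Longrightarrow>
    f \<in> T closure_of spanning (Domain f' \<inter> {..<n}) (Range f' \<inter> {..<n}) \<Longrightarrow> f' \<in> U"
proof -
  have f: "f \<in> charts" using U open_charts by blast
  have IfI: "Id O f O Id \<in> U" using U by simp
  obtain P V P' where P: "openin T P" "openin T V" "openin T P'" "Id \<in> P" "f \<in> V" "Id \<in> P'"
    "\<forall>u\<in>P. \<forall>h\<in>V. \<forall>v\<in>P'. u O h O v \<in> U"
    using mult3_nbhds[OF U(1) Id_charts f Id_charts IfI] by blast
  obtain n1 where n1: "\<And>x. x \<in> charts \<Longrightarrow> x \<inter> border n1 = Id \<inter> border n1 \<Longrightarrow> x \<in> P"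
    using open_contains_border_class[OF P(1,4)] by metis
  obtain n2 where n2: "\<And>x. x \<in> charts \<Longrightarrow> x \<inter> border n2 = Id \<inter> border n2 \<Longrightarrow> x \<in> P'"
    using open_contains_border_class[OF P(3,6)] by metis
  define n where "n = max n1 n2"
  have mono: "x \<inter> border m = y \<inter> border m" if "x \<inter> border n = y \<inter> border n" "m \<le> n" for x y m
  proof -
    have "border m \<subseteq> border n" using that(2) by (auto simp: border_def)
    then show ?thesis using that(1) by blast
  qed
  show thesis
  proof
    fix f' assume f': "f' \<in> charts" "f \<inter> border n \<subseteq> f'" "f' \<inter> {..<n} \<times> {..<n} \<subseteq> f"
      and cl: "f \<in> T closure_of spanning (Domain f' \<inter> {..<n}) (Range f' \<inter> {..<n})"
    define W where "W = V \<inter> {h \<in> charts. f \<inter> border n \<subseteq> h \<and> ({..<n} \<times> {..<n} - f) \<inter> h = {}}"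
    have W: "openin T W"
      unfolding W_def by (intro openin_Int P(2) open_finite_conditions) (auto intro: finite_border_chart f)
    moreover have "f \<in> W" unfolding W_def using P(5) f by auto
    ultimately obtain h0 where h0: "h0 \<in> W" "h0 \<in> spanning (Domain f' \<inter> {..<n}) (Range f' \<inter> {..<n})"
      using cl unfolding in_closure_iff by blast
    obtain h where h: "h \<in> W" "h0 \<subseteq> h" "infinite h"
      using open_contains_infinite[OF W h0(1)] by blast
    have hc: "h \<in> charts" "f \<inter> border n \<subseteq> h" "h \<inter> {..<n} \<times> {..<n} \<subseteq> f"
      using h(1) by (auto simp: W_def)
    have "Domain f' \<inter> {..<n} \<subseteq> Domain h" "Range f' \<inter> {..<n} \<subseteq> Range h"
      using h0(2) Domain_mono[OF h(2)] Range_mono[OF h(2)] unfolding spanning_def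
      by (simp_all only: mem_Collect_eq) (meson subset_trans)+
    then obtain u v where uv: "u \<in> charts" "v \<in> charts" "u \<inter> border n = Id \<inter> border n"
      "v \<inter> border n = Id \<inter> border n" "u O h O v = f'"
      using chart_factorization[OF f f'(1) hc(1) h(3) hc(2,3) f'(2,3)] by blast
    have "u \<in> P" "v \<in> P'"
      using n1[OF uv(1) mono[OF uv(3)]] n2[OF uv(2) mono[OF uv(4)]] by (auto simp: n_def)
    moreover have "h \<in> V" using h(1) by (simp add: W_def)
    ultimately show "f' \<in> U" using P(7) uv(5) by blast
  qed
qed

end

text \<open>Below \<open>n\<close> there are only finitely many pairs \<open>A\<close>,
  \<open>B\<close>, so the union of those \<open>T'\<close>-closures that omit \<open>f\<close> is
  closed and can be removed from a neighbourhood of \<open>f\<close>. A chart \<open>f'\<close> that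
  remains lies in the spanning set of its own domain and range below \<open>n\<close>, so the
  closure of that set must contain \<open>f\<close>.\<close>

lemma topology_le_if_closures_eq:
  assumes "chart_semigroup_topology T" "chart_semigroup_topology T'"
    and eq: "\<And>A B. finite A \<Longrightarrow> finite B \<Longrightarrow> T closure_of spanning A B = T' closure_of spanning A B"
    and U: "openin T U"
  shows "openin T' U"
proof -
  interpret T: chart_semigroup_topology T by fact
  interpret T': chart_semigroup_topology T' by fact
  show ?thesis
  proof (subst openin_subopen, safe)
    fix f assume f: "f \<in> U"
    then have fc: "f \<in> charts" using U T.open_charts by blast
    obtain n where n: "\<And>f'. f' \<in> charts \<Longrightarrow> f \<inter> border n \<subseteq> f' \<Longrightarrow> f' \<inter> {..<n} \<times> {..<n} \<subseteq> f \<Longrightarrow>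
      f \<in> T closure_of spanning (Domain f' \<inter> {..<n}) (Range f' \<inter> {..<n}) \<Longrightarrow> f' \<in> U"
      using T.open_contains_closure_class[OF U f] by blast
    define \<K> where "\<K> = {K. f \<notin> K \<and> (\<exists>A B. A \<subseteq> {..<n} \<and> B \<subseteq> {..<n} \<and> K = T' closure_of spanning A B)}"
    define W where "W = {h \<in> charts. f \<inter> border n \<subseteq> h \<and> ({..<n} \<times> {..<n} - f) \<inter> h = {}} - \<Union>\<K>"
    have "\<K> \<subseteq> (\<lambda>(A, B). T' closure_of spanning A B) ` (Pow {..<n} \<times> Pow {..<n})"
      by (auto simp: \<K>_def)
    then have "finite \<K>" by (rule finite_subset) simp
    then have "closedin T' (\<Union>\<K>)" by (rule closedin_Union) (auto simp: \<K>_def)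
    then have "openin T' W"
      unfolding W_def by (intro openin_diff T'.open_finite_conditions finite_border_chart fc) auto
    moreover have "f \<in> W" using fc by (auto simp: W_def \<K>_def)
    moreover have "W \<subseteq> U"
    proof
      fix f' assume f': "f' \<in> W"
      define A where "A = Domain f' \<inter> {..<n}"
      define B where "B = Range f' \<inter> {..<n}"
      have c: "f' \<in> charts" "f \<inter> border n \<subseteq> f'" "f' \<inter> {..<n} \<times> {..<n} \<subseteq> f" "f' \<notin> \<Union>\<K>"
        using f' by (auto simp: W_def)
      have "f' \<in> spanning A B" using c(1) by (auto simp: spanning_def A_def B_def)
      moreover have "spanning A B \<subseteq> T' closure_of spanning A B"
        by (rule closure_of_subset) (auto simp: spanning_def T'.topspace)
      ultimately have "f' \<in> T' closure_of spanning A B" by blast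
      then have "T' closure_of spanning A B \<notin> \<K>" using c(4) by blast
      then have "f \<in> T' closure_of spanning A B"
      proof (rule contrapos_np)
        assume "f \<notin> T' closure_of spanning A B"
        moreover have "A \<subseteq> {..<n}" "B \<subseteq> {..<n}" by (auto simp: A_def B_def)
        ultimately show "T' closure_of spanning A B \<in> \<K>" unfolding \<K>_def by blast
      qed
      then have "f \<in> T closure_of spanning A B" using eq[of A B] by (simp add: A_def B_def)
      then show "f' \<in> U" using n c unfolding A_def B_def by blast
    qed
    ultimately show "\<exists>W. openin T' W \<and> f \<in> W \<and> W \<subseteq> U" by blast
  qed
qed

section \<open>Behaviour of the closures under restriction and permutations\<close>

lemma ex_permutation_extending:
  fixes f :: "nat \<Rightarrow> nat"
  assumes "finite A" "bij_betw f A B"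
  obtains p where "bij p" "\<And>x. x \<in> A \<Longrightarrow> p x = f x"
proof -
  have "finite B" using assms bij_betw_finite by blast
  obtain p where "p permutes UNIV" "\<And>x. x \<in> A \<Longrightarrow> p x = f x"
    using ex_permutes_extending[OF assms(2), of UNIV] assms(1) \<open>finite B\<close> by (auto simp: finite_compl)
  then show thesis using that permutes_bij by blast
qed

lemma bij_betw_disjoint_union:
  assumes "bij_betw f A B" "bij_betw g A' B'" "A \<inter> A' = {}" "B \<inter> B' = {}"
  obtains h where "bij_betw h (A \<union> A') (B \<union> B')" "\<And>x. x \<in> A \<Longrightarrow> h x = f x" "\<And>x. x \<in> A' \<Longrightarrow> h x = g x"
proof -
  define h where "h x = (if x \<in> A then f x else g x)" for x
  have "bij_betw h A B"
    using assms(1) by (rule bij_betw_cong[THEN iffD1, rotated]) (simp add: h_def)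
  moreover have "bij_betw h A' B'"
    using assms(2) by (rule bij_betw_cong[THEN iffD1, rotated]) (use assms(3) in \<open>auto simp: h_def\<close>)
  ultimately have "bij_betw h (A \<union> A') (B \<union> B')"
    by (rule bij_betw_combine) fact
  then show thesis
    by (rule that) (use assms(3) in \<open>auto simp: h_def\<close>)
qed

text \<open>Once \<open>f\<close> and \<open>g\<close> are matched pair by pair, the domain and
  range sides are independent. Disjointness lets the induced matchings be united with matchings of
  \<open>A\<close> with \<open>A'\<close> and \<open>B\<close> with \<open>B'\<close>, and finite
  bijections extend to permutations.\<close>

lemma ex_translations:
  assumes f: "f \<in> charts" "finite f" and g: "g \<in> charts" "finite g" and card: "card f = card g"
    and A: "finite A" "finite A'" "card A = card A'" "A \<inter> Domain f = {}" "A' \<inter> Domain g = {}"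
    and B: "finite B" "finite B'" "card B = card B'" "B \<inter> Range f = {}" "B' \<inter> Range g = {}"
  obtains p q where "bij p" "bij q" "p ` A = A'" "q ` B = B'" "\<forall>x y. (p x, q y) \<in> g \<longleftrightarrow> (x, y) \<in> f"
proof -
  obtain \<phi> where \<phi>: "bij_betw \<phi> f g" using finite_same_card_bij[OF f(2) g(2) card] by blast
  obtain \<alpha> where \<alpha>: "bij_betw \<alpha> A A'" using finite_same_card_bij[OF A(1-3)] by blast
  obtain \<beta> where \<beta>: "bij_betw \<beta> B B'" using finite_same_card_bij[OF B(1-3)] by blast
  have fst_inj: "inj_on fst h" and snd_inj: "inj_on snd h" if "h \<in> charts" for h
    using charts_eqD[OF that] by (auto simp: inj_on_def)
  have fstb: "bij_betw fst h (Domain h)" and sndb: "bij_betw snd h (Range h)" if "h \<in> charts" for h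
    using fst_inj[OF that] snd_inj[OF that] by (auto simp: bij_betw_def fst_eq_Domain snd_eq_Range)
  define \<xi> where "\<xi> = fst \<circ> \<phi> \<circ> inv_into f fst"
  define \<eta> where "\<eta> = snd \<circ> \<phi> \<circ> inv_into f snd"
  have \<xi>: "bij_betw \<xi> (Domain f) (Domain g)"
    unfolding \<xi>_def by (intro bij_betw_trans[OF bij_betw_inv_into[OF fstb[OF f(1)]]] bij_betw_trans[OF \<phi> fstb[OF g(1)]])
  have \<eta>: "bij_betw \<eta> (Range f) (Range g)"
    unfolding \<eta>_def by (intro bij_betw_trans[OF bij_betw_inv_into[OF sndb[OF f(1)]]] bij_betw_trans[OF \<phi> sndb[OF g(1)]])
  obtain \<xi>' where \<xi>': "bij_betw \<xi>' (Domain f \<union> A) (Domain g \<union> A')"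
    "\<And>x. x \<in> Domain f \<Longrightarrow> \<xi>' x = \<xi> x" "\<And>x. x \<in> A \<Longrightarrow> \<xi>' x = \<alpha> x"
    by (rule bij_betw_disjoint_union[OF \<xi> \<alpha>]) (use A(4,5) in auto)
  obtain \<eta>' where \<eta>': "bij_betw \<eta>' (Range f \<union> B) (Range g \<union> B')"
    "\<And>x. x \<in> Range f \<Longrightarrow> \<eta>' x = \<eta> x" "\<And>x. x \<in> B \<Longrightarrow> \<eta>' x = \<beta> x"
    by (rule bij_betw_disjoint_union[OF \<eta> \<beta>]) (use B(4,5) in auto)
  obtain p where p: "bij p" "\<And>x. x \<in> Domain f \<union> A \<Longrightarrow> p x = \<xi>' x"
    by (rule ex_permutation_extending[OF _ \<xi>'(1)]) (use f(2) A(1) in \<open>auto simp: finite_Domain\<close>)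
  obtain q where q: "bij q" "\<And>x. x \<in> Range f \<union> B \<Longrightarrow> q x = \<eta>' x"
    by (rule ex_permutation_extending[OF _ \<eta>'(1)]) (use f(2) B(1) in \<open>auto simp: finite_Range\<close>)
  have pq: "\<phi> (x, y) = (p x, q y)" if "(x, y) \<in> f" for x y
  proof -
    have "inv_into f fst x = (x, y)" "inv_into f snd y = (x, y)"
      using inv_into_f_f[OF fst_inj[OF f(1)] that] inv_into_f_f[OF snd_inj[OF f(1)] that] by simp_all
    moreover have "x \<in> Domain f" "y \<in> Range f" using that by blast+
    then have "p x = \<xi> x" "q y = \<eta> y" by (simp_all add: p(2) q(2) \<xi>'(2) \<eta>'(2))
    ultimately show ?thesis by (simp add: \<xi>_def \<eta>_def)
  qed
  show thesis
  proof
    show "bij p" "bij q" by fact+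
    show "p ` A = A'" using p(2) \<xi>'(3) \<alpha> by (simp add: bij_betw_def)
    show "q ` B = B'" using q(2) \<eta>'(3) \<beta> by (simp add: bij_betw_def)
    have "(p x, q y) \<in> g \<longleftrightarrow> (x, y) \<in> f" for x y
    proof
      assume "(x, y) \<in> f"
      then show "(p x, q y) \<in> g" using pq \<phi> by (metis bij_betwE)
    next
      assume "(p x, q y) \<in> g"
      then obtain x' y' where "(x', y') \<in> f" "\<phi> (x', y') = (p x, q y)"
        using \<phi> by (metis bij_betw_imp_surj_on imageE surj_pair)
      then show "(x, y) \<in> f" using pq p(1) q(1) by (metis Pair_inject bij_pointE)
    qed
    then show "\<forall>x y. (p x, q y) \<in> g \<longleftrightarrow> (x, y) \<in> f" by blast
  qed
qed

context chart_semigroup_topology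
begin

text \<open>Left multiplication by \<open>Id_on E\<close> cuts \<open>f\<close> down to
  \<open>f'\<close> and keeps the points of \<open>A\<close>, but could cut off preimages of
  \<open>B\<close> in a spanning chart near \<open>f\<close>. Since \<open>B\<close> misses
  \<open>Range f\<close>, these preimages can be forced beyond any \<open>m\<close>; the idempotent
  \<open>e\<close>, close to \<open>Id_on E\<close> but containing the diagonal from
  \<open>m\<close> on, preserves them.\<close>

lemma closure_spanning_restrict:
  assumes cl: "f \<in> T closure_of spanning A B" and sub: "f' \<subseteq> f"
    and A: "finite A" "A \<inter> Domain f = {}" and B: "finite B" "B \<inter> Range f = {}"
  shows "f' \<in> T closure_of spanning A B"
  unfolding in_closure_iff
proof (intro conjI allI impI)
  have f: "f \<in> charts" using cl by (simp add: in_closure_iff)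
  then show "f' \<in> charts" using sub by (rule charts_subset)
  fix U assume U: "openin T U \<and> f' \<in> U"
  define E where "E = - (Domain f - Domain f')"
  have "Id_on E O f = f'"
    using sub charts_eqD[OF f] by (auto simp: E_def)
  then have mem: "Id_on E O f \<in> U" using U by simp
  obtain P V where P: "openin T P" "openin T V" "Id_on E \<in> P" "f \<in> V" "\<forall>e\<in>P. \<forall>h\<in>V. e O h \<in> U"
    using mult_nbhds[OF conjunct1[OF U] Id_on_charts f mem] by blast
  obtain m where m: "\<And>x. x \<in> charts \<Longrightarrow> x \<inter> border m = Id_on E \<inter> border m \<Longrightarrow> x \<in> P"
    using open_contains_border_class[OF P(1,3)] by metis
  define e where "e = Id_on (E \<union> {m..})"
  have "e \<in> P"
    by (rule m) (auto simp: e_def Id_on_charts border_def)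
  define W where "W = V \<inter> {h \<in> charts. {} \<subseteq> h \<and> ({..<m} \<times> B) \<inter> h = {}}"
  have "openin T W"
    unfolding W_def using B(1) by (intro openin_Int P(2) open_finite_conditions) auto
  moreover have "f \<in> W" unfolding W_def using P(4) f B(2) by auto
  ultimately obtain h where h: "h \<in> spanning A B" "h \<in> W" using cl unfolding in_closure_iff by blast
  have hc: "h \<in> charts" using h(1) by (simp add: spanning_def)
  have "A \<subseteq> Domain (e O h)"
  proof
    fix a assume "a \<in> A"
    then have "a \<in> E" "a \<in> Domain h" using A(2) h(1) by (auto simp: E_def spanning_def)
    then show "a \<in> Domain (e O h)" by (auto simp: e_def)
  qed
  moreover have "B \<subseteq> Range (e O h)"
  proof
    fix b assume b: "b \<in> B"
    then obtain z where z: "(z, b) \<in> h" using h(1) by (auto simp: spanning_def)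
    then have "m \<le> z" using h(2) b by (auto simp: W_def not_less[symmetric])
    then show "b \<in> Range (e O h)" using z by (auto simp: e_def)
  qed
  ultimately have "e O h \<in> spanning A B"
    using hc by (auto simp: spanning_def e_def intro!: relcomp_charts Id_on_charts)
  moreover have "e O h \<in> U" using P(5) \<open>e \<in> P\<close> h(2) by (auto simp: W_def)
  ultimately show "\<exists>h\<in>spanning A B. h \<in> U" by blast
qed

text \<open>Every neighbourhood of \<open>f\<close> already contains the finite chart
  \<open>f \<inter> border n\<close> for a suitable \<open>n\<close>.\<close>

lemma closure_if_finite_restrictions:
  assumes f: "f \<in> charts" and fin: "\<And>f'. finite f' \<Longrightarrow> f' \<subseteq> f \<Longrightarrow> f' \<in> T closure_of S"
  shows "f \<in> T closure_of S"
  unfolding in_closure_iff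
proof (intro conjI allI impI)
  fix U assume U: "openin T U \<and> f \<in> U"
  obtain n where n: "\<And>x. x \<in> charts \<Longrightarrow> x \<inter> border n = f \<inter> border n \<Longrightarrow> x \<in> U"
    using open_contains_border_class[OF conjunct1[OF U] conjunct2[OF U]] by metis
  have "f \<inter> border n \<in> U" by (rule n) (auto intro: charts_subset[OF f])
  moreover have "f \<inter> border n \<in> T closure_of S" using finite_border_chart[OF f] by (intro fin) auto
  ultimately show "\<exists>h\<in>S. h \<in> U" using U unfolding in_closure_iff by blast
qed (rule f)

text \<open>Charts close to \<open>f\<close> contain its finitely many pairs at points of
  \<open>A\<close> and \<open>B\<close>, so the points already covered by \<open>f\<close> are
  spanned automatically.\<close>

lemma closure_spanning_disjoint:
  assumes f: "f \<in> charts" and fin: "finite A" "finite B"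
  shows "f \<in> T closure_of spanning A B \<longleftrightarrow> f \<in> T closure_of spanning (A - Domain f) (B - Range f)"
proof
  have "spanning A B \<subseteq> spanning (A - Domain f) (B - Range f)" by (auto simp: spanning_def)
  then show "f \<in> T closure_of spanning A B \<Longrightarrow> f \<in> T closure_of spanning (A - Domain f) (B - Range f)"
    using closure_of_mono by blast
  assume cl: "f \<in> T closure_of spanning (A - Domain f) (B - Range f)"
  show "f \<in> T closure_of spanning A B"
    unfolding in_closure_iff
  proof (intro conjI allI impI)
    fix U assume U: "openin T U \<and> f \<in> U"
    obtain n where n: "A \<union> B \<subseteq> {..<n}"
      by (metis finite_nat_iff_bounded finite_Un fin)
    define W where "W = U \<inter> {h \<in> charts. f \<inter> border n \<subseteq> h \<and> {} \<inter> h = {}}"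
    have "openin T W"
      unfolding W_def using U by (intro openin_Int open_finite_conditions finite_border_chart f) auto
    moreover have "f \<in> W" using U f by (auto simp: W_def)
    ultimately obtain h where h: "h \<in> spanning (A - Domain f) (B - Range f)" "h \<in> W"
      using cl unfolding in_closure_iff by blast
    have "f \<inter> border n \<subseteq> h" using h(2) by (simp add: W_def)
    then have "A \<inter> Domain f \<subseteq> Domain h" "B \<inter> Range f \<subseteq> Range h"
      using n by (fastforce simp: border_def)+
    then have "h \<in> spanning A B" using h(1) by (auto simp: spanning_def)
    then show "\<exists>h\<in>spanning A B. h \<in> U" using h(2) by (auto simp: W_def)
  qed (rule f)
qed

text \<open>Multiplication by permutations on both sides is continuous, carries \<open>f\<close> to
  \<open>g\<close>, and carries \<open>spanning A B\<close> into
  \<open>spanning A' B'\<close>.\<close>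

lemma closure_spanning_invariant:
  assumes f: "f \<in> charts" "finite f" and g: "g \<in> charts" "finite g" and card: "card f = card g"
    and A: "finite A" "finite A'" "card A = card A'" "A \<inter> Domain f = {}" "A' \<inter> Domain g = {}"
    and B: "finite B" "finite B'" "card B = card B'" "B \<inter> Range f = {}" "B' \<inter> Range g = {}"
    and cl: "f \<in> T closure_of spanning A B"
  shows "g \<in> T closure_of spanning A' B'"
  unfolding in_closure_iff
proof (intro conjI allI impI)
  fix U assume U: "openin T U \<and> g \<in> U"
  obtain p q where pq: "bij p" "bij q" "p ` A = A'" "q ` B = B'" "\<forall>x y. (p x, q y) \<in> g \<longleftrightarrow> (x, y) \<in> f"
    by (rule ex_translations[OF f g card A B]) (rule that)
  define a where "a = (fgraph p)\<inverse>"
  define b where "b = fgraph q"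
  have ab: "a \<in> charts" "b \<in> charts"
    using pq(1,2) by (auto simp: a_def b_def bij_is_inj intro!: converse_charts fgraph_charts)
  have rel: "(u, w) \<in> a O h O b \<longleftrightarrow> (\<exists>x y. u = p x \<and> w = q y \<and> (x, y) \<in> h)" for u w h
    unfolding a_def b_def by (simp add: relcomp_unfold) blast
  have mem: "(p x, q y) \<in> a O h O b \<longleftrightarrow> (x, y) \<in> h" for x y h
    unfolding rel by (simp add: inj_eq[OF bij_is_inj[OF pq(1)]] inj_eq[OF bij_is_inj[OF pq(2)]])
  have "a O f O b = g"
  proof -
    have "(x, y) \<in> a O f O b \<longleftrightarrow> (x, y) \<in> g" for x y
    proof -
      obtain x0 y0 where "x = p x0" "y = q y0" using pq(1,2) by (metis bij_pointE)
      then show ?thesis using pq(5) by (simp only: mem)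
    qed
    then show ?thesis by auto
  qed
  then have "f \<in> {x \<in> charts. a O x O b \<in> U}" using U f by simp
  moreover have "openin T {x \<in> charts. a O x O b \<in> U}" using U ab by (intro open_preimage_mult) auto
  ultimately obtain h where h: "h \<in> spanning A B" "h \<in> charts" "a O h O b \<in> U"
    using cl unfolding in_closure_iff by blast
  have "A' \<subseteq> Domain (a O h O b)"
  proof
    fix x' assume "x' \<in> A'"
    then obtain x y where "x' = p x" "(x, y) \<in> h" using pq(3) h(1) by (auto simp: spanning_def)
    then show "x' \<in> Domain (a O h O b)" using mem[of x y h] by blast
  qed
  moreover have "B' \<subseteq> Range (a O h O b)"
  proof
    fix y' assume "y' \<in> B'"
    then obtain x y where "y' = q y" "(x, y) \<in> h" using pq(4) h(1) by (auto simp: spanning_def)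
    then show "y' \<in> Range (a O h O b)" using mem[of x y h] by blast
  qed
  ultimately have "a O h O b \<in> spanning A' B'"
    using h(2) ab by (auto simp: spanning_def intro!: relcomp_charts)
  then show "\<exists>h\<in>spanning A' B'. h \<in> U" using h(3) by blast
qed (rule g)

end

text \<open>Thanks to the disjointness conditions the three cardinalities classify the
  configurations of \<open>f\<close>, \<open>A\<close> and \<open>B\<close> up to permutations on
  both sides.\<close>

definition profile :: "(nat \<times> nat) set topology \<Rightarrow> (nat \<times> nat \<times> nat) set" where
  "profile T = {(r, a, b). \<exists>f A B. f \<in> charts \<and> finite f \<and> card f = r \<and>
     finite A \<and> card A = a \<and> A \<inter> Domain f = {} \<and>
     finite B \<and> card B = b \<and> B \<inter> Range f = {} \<and> f \<in> T closure_of spanning A B}"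

text \<open>An infinite \<open>f\<close> has no finite rank, so it enters through its finite
  subcharts; invariance reduces each of these to its cardinality. The sets are trimmed by
  \<open>f\<close> itself, not by the subchart, and so have the same sizes for all
  subcharts.\<close>

lemma (in chart_semigroup_topology) closure_iff_profile:
  assumes f: "f \<in> charts" and A: "finite A" and B: "finite B"
  shows "f \<in> T closure_of spanning A B \<longleftrightarrow>
    (\<forall>f'. finite f' \<longrightarrow> f' \<subseteq> f \<longrightarrow> (card f', card (A - Domain f), card (B - Range f)) \<in> profile T)"
proof -
  let ?A = "A - Domain f" and ?B = "B - Range f"
  have fin: "f' \<in> T closure_of spanning ?A ?B \<longleftrightarrow> (card f', card ?A, card ?B) \<in> profile T"
    if f': "finite f'" "f' \<subseteq> f" for f'
  proof -
    have f'c: "f' \<in> charts" using f f'(2) by (rule charts_subset)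
    have dj: "?A \<inter> Domain f' = {}" "?B \<inter> Range f' = {}" "finite ?A" "finite ?B" using f'(2) A B by auto
    show ?thesis
    proof
      assume "f' \<in> T closure_of spanning ?A ?B"
      then show "(card f', card ?A, card ?B) \<in> profile T"
        unfolding profile_def using f'(1) f'c dj by blast
    next
      assume "(card f', card ?A, card ?B) \<in> profile T"
      then obtain g A' B' where g: "g \<in> charts" "finite g" "card g = card f'"
        "finite A'" "card A' = card ?A" "A' \<inter> Domain g = {}"
        "finite B'" "card B' = card ?B" "B' \<inter> Range g = {}" "g \<in> T closure_of spanning A' B'"
        unfolding profile_def by auto
      show "f' \<in> T closure_of spanning ?A ?B"
        by (rule closure_spanning_invariant[OF g(1,2) f'c f'(1) g(3) g(4) dj(3) g(5,6) dj(1) g(7) dj(4) g(8,9) dj(2) g(10)])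
    qed
  qed
  have "f \<in> T closure_of spanning A B \<longleftrightarrow> f \<in> T closure_of spanning ?A ?B"
    by (rule closure_spanning_disjoint[OF f A B])
  also have "\<dots> \<longleftrightarrow> (\<forall>f'. finite f' \<longrightarrow> f' \<subseteq> f \<longrightarrow> f' \<in> T closure_of spanning ?A ?B)"
    using closure_spanning_restrict[of f ?A ?B] closure_if_finite_restrictions[OF f] A B by blast
  finally show ?thesis using fin by simp
qed

lemma profile_inj:
  assumes "chart_semigroup_topology T" "chart_semigroup_topology T'" "profile T = profile T'"
  shows "T = T'"
proof -
  interpret T: chart_semigroup_topology T by fact
  interpret T': chart_semigroup_topology T' by fact
  have "T closure_of spanning A B = T' closure_of spanning A B" if "finite A" "finite B" for A B
    using T.closure_iff_profile[OF _ that] T'.closure_iff_profile[OF _ that] assms(3)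
      T.in_closure_iff T'.in_closure_iff by (intro set_eqI) metis
  then show ?thesis
    using topology_le_if_closures_eq[OF assms(1,2)] topology_le_if_closures_eq[OF assms(2,1)]
    by (auto simp: topology_eq)
qed

text \<open>Restriction lowers the rank; the other two entries may shrink because
  \<open>spanning\<close> is antitone in both arguments.\<close>

lemma (in chart_semigroup_topology) profile_downward:
  assumes "(r, a, b) \<in> profile T" "r' \<le> r" "a' \<le> a" "b' \<le> b"
  shows "(r', a', b') \<in> profile T"
proof -
  obtain f A B where f: "f \<in> charts" "finite f" "card f = r"
    "finite A" "card A = a" "A \<inter> Domain f = {}"
    "finite B" "card B = b" "B \<inter> Range f = {}" "f \<in> T closure_of spanning A B"
    using assms(1) unfolding profile_def by auto
  obtain f' where f': "f' \<subseteq> f" "card f' = r'" "finite f'" using obtain_subset_with_card_n f(2,3) assms(2) by metis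
  obtain A' where A': "A' \<subseteq> A" "card A' = a'" "finite A'" using obtain_subset_with_card_n f(4,5) assms(3) by metis
  obtain B' where B': "B' \<subseteq> B" "card B' = b'" "finite B'" using obtain_subset_with_card_n f(7,8) assms(4) by metis
  have "f' \<in> T closure_of spanning A B"
    by (rule closure_spanning_restrict[OF f(10) f'(1) f(4,6,7,9)])
  moreover have "spanning A B \<subseteq> spanning A' B'" using A'(1) B'(1) by (auto simp: spanning_def)
  ultimately have "f' \<in> T closure_of spanning A' B'" using closure_of_mono by blast
  moreover have "A' \<inter> Domain f' = {}" "B' \<inter> Range f' = {}"
    using A'(1) B'(1) Domain_mono[OF f'(1)] Range_mono[OF f'(1)] f(6,9) by blast+
  ultimately show ?thesis
    unfolding profile_def using f' A' B' charts_subset[OF f(1) f'(1)] by blast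
qed

section \<open>Countably many profiles\<close>

text \<open>A nonincreasing sequence of naturals is constant once it reaches its minimum, so the
  decreasing alternative also yields a monotone subsequence.\<close>

lemma nat_mono_subseq:
  fixes s :: "nat \<Rightarrow> nat"
  shows "\<exists>r::nat \<Rightarrow> nat. strict_mono r \<and> mono (\<lambda>n. s (r n))"
proof -
  obtain f where f: "strict_mono f" "monoseq (\<lambda>n. s (f n))"
    using seq_monosub[of s] by blast
  show ?thesis
  proof (cases "\<forall>m n. m \<le> n \<longrightarrow> s (f m) \<le> s (f n)")
    case True
    then show ?thesis using f(1) by (auto simp: mono_def)
  next
    case False
    then have dec: "s (f n) \<le> s (f m)" if "m \<le> n" for m n
      using f(2) that by (auto simp: monoseq_def)
    obtain m where m: "\<And>n. s (f m) \<le> s (f n)"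
      using ex_has_least_nat[of "\<lambda>_. True" _ "\<lambda>n. s (f n)"] by blast
    have "strict_mono (\<lambda>n. f (m + n))"
      using f(1) by (auto simp: strict_mono_def)
    moreover have "s (f (m + n)) = s (f m)" for n
      using dec[of m "m + n"] m[of "m + n"] by simp
    ultimately show ?thesis by (intro exI[of _ "\<lambda>n. f (m + n)"]) (simp add: mono_def)
  qed
qed

lemma prod_mono_subseq:
  fixes s :: "nat \<Rightarrow> 'a::order \<times> 'b::order"
  assumes "\<And>s::nat \<Rightarrow> 'a. \<exists>r::nat \<Rightarrow> nat. strict_mono r \<and> mono (\<lambda>n. s (r n))"
    "\<And>s::nat \<Rightarrow> 'b. \<exists>r::nat \<Rightarrow> nat. strict_mono r \<and> mono (\<lambda>n. s (r n))"
  shows "\<exists>r::nat \<Rightarrow> nat. strict_mono r \<and> mono (\<lambda>n. s (r n))"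
proof -
  obtain r :: "nat \<Rightarrow> nat" where r: "strict_mono r" "mono (\<lambda>n. fst (s (r n)))"
    using assms(1)[of "\<lambda>n. fst (s n)"] by blast
  obtain q :: "nat \<Rightarrow> nat" where q: "strict_mono q" "mono (\<lambda>n. snd (s (r (q n))))"
    using assms(2)[of "\<lambda>n. snd (s (r n))"] by blast
  have "strict_mono (\<lambda>n. r (q n))" using r(1) q(1) by (auto simp: strict_mono_def)
  moreover have "mono (\<lambda>n. s (r (q n)))"
    using r(2) q strict_mono_mono[OF q(1)] by (auto simp: mono_def less_eq_prod_def)
  ultimately show ?thesis by (intro exI[of _ "\<lambda>n. r (q n)"]) simp
qed

text \<open>A downward closed set is determined by the minimal elements of its complement, which
  exist by well-foundedness. They form an antichain, hence a finite set, and a countable type has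
  only countably many finite subsets.\<close>

lemma countable_downward_closed:
  assumes "\<And>s::nat \<Rightarrow> 'a::{order,countable}. \<exists>r::nat \<Rightarrow> nat. strict_mono r \<and> mono (\<lambda>n. s (r n))"
  shows "countable {P::'a set. \<forall>p\<in>P. \<forall>q\<le>p. q \<in> P}"
proof -
  have good: "\<exists>i j. i < j \<and> s i \<le> s j" for s :: "nat \<Rightarrow> 'a"
  proof -
    obtain r :: "nat \<Rightarrow> nat" where "strict_mono r" "mono (\<lambda>n. s (r n))" using assms[of s] by blast
    then have "r 0 < r 1" "s (r 0) \<le> s (r 1)" by (auto simp: strict_mono_def mono_def)
    then show ?thesis by blast
  qed
  have wf: "wf {(x::'a, y). x < y}"
    unfolding wf_iff_no_infinite_down_chain
  proof
    assume "\<exists>f. \<forall>i. (f (Suc i), f i) \<in> {(x::'a, y). x < y}"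
    then obtain f :: "nat \<Rightarrow> 'a" where f: "\<And>i. f (Suc i) < f i" by auto
    have "f j < f i" if "i < j" for i j
      using that by (induction rule: less_Suc_induct) (auto intro: f less_trans)
    then show False using good[of f] by (metis leD)
  qed
  have "P \<in> (\<lambda>F. {p. \<not> (\<exists>m\<in>F. m \<le> p)}) ` Collect finite" if P: "\<forall>p\<in>P. \<forall>q\<le>p. q \<in> P" for P :: "'a set"
  proof
    define F where "F = {m. m \<notin> P \<and> (\<forall>q. q < m \<longrightarrow> q \<in> P)}"
    show "F \<in> Collect finite"
    proof (rule ccontr)
      assume "F \<notin> Collect finite"
      then obtain s :: "nat \<Rightarrow> 'a" where s: "inj s" "range s \<subseteq> F"
        using infinite_countable_subset[of F] by auto
      obtain i j where ij: "i < j" "s i \<le> s j" using good by blast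
      then have "s i < s j" using s(1) by (auto simp: order.strict_iff_order inj_def)
      moreover have "s i \<in> F" "s j \<in> F" using s(2) by auto
      ultimately show False by (simp add: F_def)
    qed
    show "P = {p. \<not> (\<exists>m\<in>F. m \<le> p)}"
    proof (intro equalityI subsetI CollectI notI)
      fix p assume "p \<in> P" "\<exists>m\<in>F. m \<le> p"
      then show False using P by (auto simp: F_def)
    next
      fix p assume p: "p \<in> {p. \<not> (\<exists>m\<in>F. m \<le> p)}"
      show "p \<in> P"
      proof (rule ccontr)
        assume "p \<notin> P"
        then obtain m where m: "m \<notin> P \<and> m \<le> p" "\<And>q. q < m \<Longrightarrow> \<not> (q \<notin> P \<and> q \<le> p)"
          using wfE_min[OF wf, of p "{m. m \<notin> P \<and> m \<le> p}"] by auto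
        then have "q \<in> P" if "q < m" for q
          using that by (meson less_imp_le order.trans)
        then have "m \<in> F" using m(1) by (auto simp: F_def)
        then show False using m p by blast
      qed
    qed
  qed
  then have "{P::'a set. \<forall>p\<in>P. \<forall>q\<le>p. q \<in> P} \<subseteq> (\<lambda>F. {p. \<not> (\<exists>m\<in>F. m \<le> p)}) ` Collect finite"
    by (intro subsetI) (simp only: mem_Collect_eq)
  then show ?thesis
    by (rule countable_subset) (intro countable_image countable_Collect_finite)
qed

section \<open>Application to Polish semigroup topologies\<close>

lemma Polish_imp_chart_semigroup_topology:
  assumes "Polish_space T" "semigroup_topology_on (sym_inv_monoid UNIV) (O) T"
  shows "chart_semigroup_topology T"
proof
  have met: "metrizable_space T"
    using assms(1) by (simp add: Polish_space_def completely_metrizable_imp_metrizable_space)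
  show "topspace T = charts" "continuous_map (prod_topology T T) T (\<lambda>(x, y). x O y)"
    using assms(2) by (auto simp: semigroup_topology_on_def)
  show "second_countable T"
    by (rule separable_metrizable_imp_second_countable[OF met]) (use assms(1) in \<open>simp add: Polish_space_def\<close>)
  show "t1_space T"
    using met by (simp add: metrizable_imp_Hausdorff_space Hausdorff_imp_t1_space)
qed

lemma countable_Polish_chart_semigroup_topologies:
  "countable {T :: (nat \<times> nat) set topology.
     Polish_space T \<and> semigroup_topology_on (sym_inv_monoid UNIV) (O) T}" (is "countable ?\<T>")
proof -
  have "inj_on profile ?\<T>"
    by (auto intro!: inj_onI profile_inj Polish_imp_chart_semigroup_topology)
  moreover have "profile ` ?\<T> \<subseteq> {P. \<forall>p\<in>P. \<forall>q\<le>p. q \<in> P}"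
    using chart_semigroup_topology.profile_downward[OF Polish_imp_chart_semigroup_topology] by fastforce
  moreover have "countable {P::(nat \<times> nat \<times> nat) set. \<forall>p\<in>P. \<forall>q\<le>p. q \<in> P}"
    by (intro countable_downward_closed prod_mono_subseq nat_mono_subseq)
  ultimately show ?thesis
    by (meson countable_image_inj_on countable_subset)
qed

section \<open>Infinitely many topologies\<close>

text \<open>\<open>coords k h\<close> records \<open>h\<close> as a partial function (with \<open>0\<close> for "undefined") and, for each
  finite set, whether \<open>Range h\<close> meets it in more than \<open>k\<close> points.\<close>

definition coords :: "nat \<Rightarrow> (nat \<times> nat) set \<Rightarrow> nat + nat \<Rightarrow> nat" where
  "coords k h i = (case i of
     Inl x \<Rightarrow> if x \<in> Domain h then Suc (THE y. (x, y) \<in> h) else 0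
   | Inr j \<Rightarrow> if card (Range h \<inter> set_decode j) \<le> k then 0 else 1)"

text \<open>Defining it as a pullback from a countable power of the discrete naturals reduces
  Polishness to a property of the image of \<open>coords k\<close>.\<close>

definition range_bound_topology :: "nat \<Rightarrow> (nat \<times> nat) set topology" where
  "range_bound_topology k = pullback_topology charts (coords k) euclidean"

lemma coords_Inl:
  assumes "h \<in> charts"
  shows "coords k h (Inl x) = Suc y \<longleftrightarrow> (x, y) \<in> h" "coords k h (Inl x) = 0 \<longleftrightarrow> x \<notin> Domain h"
proof -
  have "(THE y. (x, y) \<in> h) = y" if "(x, y) \<in> h" for y
    using that charts_eqD(1)[OF assms that] by blast
  then show "coords k h (Inl x) = Suc y \<longleftrightarrow> (x, y) \<in> h" "coords k h (Inl x) = 0 \<longleftrightarrow> x \<notin> Domain h"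
    by (auto simp: coords_def)
qed

lemma topspace_range_bound: "topspace (range_bound_topology k) = charts"
  by (simp add: range_bound_topology_def topspace_pullback_topology)

lemma open_coord: "open {\<phi> :: 'a \<Rightarrow> nat. P (\<phi> i)}"
proof -
  have "open ((\<lambda>\<phi> :: 'a \<Rightarrow> nat. \<phi> i) -` Collect P)"
    by (intro open_vimage open_discrete continuous_on_product_coordinates)
  then show ?thesis
    by (simp add: vimage_def)
qed

lemma open_range_bound_coord: "openin (range_bound_topology k) {h \<in> charts. P (coords k h i)}"
  unfolding range_bound_topology_def openin_pullback_topology
proof (intro exI conjI)
  show "openin euclidean {\<phi> :: nat + nat \<Rightarrow> nat. P (\<phi> i)}" using open_coord by simp
  show "{h \<in> charts. P (coords k h i)} = coords k -` {\<phi>. P (\<phi> i)} \<inter> charts" by auto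
qed

lemma open_range_bound:
  shows "openin (range_bound_topology k) {h \<in> charts. (x, y) \<in> h}"
    "openin (range_bound_topology k) {h \<in> charts. x \<notin> Domain h}"
    "finite F \<Longrightarrow> openin (range_bound_topology k) {h \<in> charts. card (Range h \<inter> F) \<le> k}"
proof -
  have "{h \<in> charts. (x, y) \<in> h} = {h \<in> charts. coords k h (Inl x) = Suc y}"
    using coords_Inl(1) by blast
  then show "openin (range_bound_topology k) {h \<in> charts. (x, y) \<in> h}"
    using open_range_bound_coord[of k "\<lambda>v. v = Suc y" "Inl x"] by simp
  have "{h \<in> charts. x \<notin> Domain h} = {h \<in> charts. coords k h (Inl x) = 0}"
    using coords_Inl(2) by blast
  then show "openin (range_bound_topology k) {h \<in> charts. x \<notin> Domain h}"
    using open_range_bound_coord[of k "\<lambda>v. v = 0" "Inl x"] by simp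
  assume "finite F"
  then have "{h \<in> charts. card (Range h \<inter> F) \<le> k} = {h \<in> charts. coords k h (Inr (set_encode F)) = 0}"
    by (auto simp: coords_def set_encode_inverse)
  then show "openin (range_bound_topology k) {h \<in> charts. card (Range h \<inter> F) \<le> k}"
    using open_range_bound_coord[of k "\<lambda>v. v = 0" "Inr (set_encode F)"] by simp
qed

lemma open_range_bound_superset:
  assumes "finite P"
  shows "openin (range_bound_topology k) {h \<in> charts. P \<subseteq> h}"
  using assms
proof induction
  case empty
  show ?case using openin_topspace[of "range_bound_topology k"] by (simp add: topspace_range_bound)
next
  case (insert p P)
  have "{h \<in> charts. insert p P \<subseteq> h} = {h \<in> charts. (fst p, snd p) \<in> h} \<inter> {h \<in> charts. P \<subseteq> h}"
    by auto
  then show ?case using insert.IH open_range_bound(1) by (simp only: openin_Int)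
qed

lemma finite_preimage_chart:
  assumes "k \<in> charts" "finite F"
  shows "finite {p \<in> k. snd p \<in> F}"
proof (rule inj_on_finite[of snd _ F])
  show "inj_on snd {p \<in> k. snd p \<in> F}"
    using charts_eqD(2)[OF assms(1)] by (auto simp: inj_on_def)
qed (use assms(2) in auto)

lemma card_Image_chart:
  assumes "R \<in> charts" "finite S"
  shows "finite (R `` S)" "card (R `` S) \<le> card S"
proof -
  have sub: "R `` S \<subseteq> (\<lambda>x. THE y. (x, y) \<in> R) ` S"
  proof
    fix y assume "y \<in> R `` S"
    then obtain x where x: "x \<in> S" "(x, y) \<in> R" by blast
    then have "(THE y. (x, y) \<in> R) = y" using charts_eqD(1)[OF assms(1) x(2)] by blast
    then show "y \<in> (\<lambda>x. THE y. (x, y) \<in> R) ` S" using x(1) by blast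
  qed
  then show "finite (R `` S)" by (rule finite_subset) (use assms(2) in simp)
  show "card (R `` S) \<le> card S"
    using card_mono[OF _ sub] card_image_le[OF assms(2)] assms(2) by (meson finite_imageI le_trans)
qed

text \<open>If \<open>g\<close> has \<open>k\<close> range points \<open>Y\<close>, nearby charts
  share them, and the bound \<open>k\<close> on \<open>insert y Y\<close> then forbids any new range
  point \<open>y\<close> in \<open>F\<close>. So over \<open>F\<close> a nearby \<open>g'\<close>
  uses only pairs of \<open>g\<close>, and it suffices to bound the range of \<open>h'\<close> on
  the finite preimage \<open>Z\<close> of \<open>F\<close> under \<open>g\<close>.\<close>

lemma range_relcomp_nbhds:
  assumes h: "h \<in> charts" and g: "g \<in> charts" and F: "finite F" and le: "card (Range (h O g) \<inter> F) \<le> k"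
  obtains U V where "openin (range_bound_topology k) U" "openin (range_bound_topology k) V"
    "h \<in> U" "g \<in> V" "\<forall>h'\<in>U. \<forall>g'\<in>V. card (Range (h' O g') \<inter> F) \<le> k"
proof (cases "\<exists>Y\<subseteq>Range g. finite Y \<and> card Y = k")
  case True
  then obtain Y where Y: "Y \<subseteq> Range g" "finite Y" "card Y = k" by blast
  define P where "P = {p \<in> g. snd p \<in> F \<union> Y}"
  have P: "finite P" unfolding P_def using F Y by (intro finite_preimage_chart g) auto
  define Z where "Z = fst ` {p \<in> g. snd p \<in> F}"
  have Z: "finite Z" unfolding Z_def using F by (intro finite_imageI finite_preimage_chart g)
  define \<N> where "\<N> = (\<lambda>y. {g' \<in> charts. card (Range g' \<inter> insert y Y) \<le> k}) ` (F - Range g)"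
  define V where "V = \<Inter>(insert {g' \<in> charts. P \<subseteq> g'} \<N>)"
  define U where "U = {h' \<in> charts. card (Range h' \<inter> Z) \<le> k}"
  show thesis
  proof
    show "openin (range_bound_topology k) U"
      unfolding U_def using Z by (rule open_range_bound(3))
    show "openin (range_bound_topology k) V"
      unfolding V_def
    proof (rule openin_Inter)
      show "finite (insert {g' \<in> charts. P \<subseteq> g'} \<N>)" using F by (simp add: \<N>_def)
      show "openin (range_bound_topology k) X" if "X \<in> insert {g' \<in> charts. P \<subseteq> g'} \<N>" for X
        using that open_range_bound_superset[OF P] open_range_bound(3) Y(2) by (auto simp: \<N>_def)
    qed simp
    have "Range h \<inter> Z \<subseteq> g\<inverse> `` (Range (h O g) \<inter> F)"
      by (auto simp: Z_def) blast
    then have "card (Range h \<inter> Z) \<le> card (Range (h O g) \<inter> F)"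
      using card_Image_chart[OF converse_charts[OF g], of "Range (h O g) \<inter> F"] F
      by (meson card_Image_chart(1) card_mono finite_Int le_trans converse_charts g)
    then show "h \<in> U" using h le by (simp add: U_def)
    have "Range g \<inter> insert y Y = Y" if "y \<notin> Range g" for y using that Y(1) by blast
    then show "g \<in> V" using g Y(3) by (auto simp: V_def \<N>_def P_def)
    show "\<forall>h'\<in>U. \<forall>g'\<in>V. card (Range (h' O g') \<inter> F) \<le> k"
    proof (intro ballI)
      fix h' g' assume h': "h' \<in> U" and g': "g' \<in> V"
      have g'c: "g' \<in> charts" "P \<subseteq> g'" using g' by (auto simp: V_def)
      have "Y \<subseteq> Range g'"
      proof
        fix y assume "y \<in> Y"
        then obtain z where "(z, y) \<in> P" using Y(1) by (auto simp: P_def)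
        then show "y \<in> Range g'" using g'c(2) by blast
      qed
      have ranF: "y \<in> Range g" if "y \<in> Range g'" "y \<in> F" for y
      proof (rule ccontr)
        assume y: "y \<notin> Range g"
        then have "card (Range g' \<inter> insert y Y) \<le> k" using g' that(2) by (auto simp: V_def \<N>_def)
        moreover have "Range g' \<inter> insert y Y = insert y Y" using that(1) \<open>Y \<subseteq> Range g'\<close> by blast
        moreover have "y \<notin> Y" using y Y(1) by blast
        ultimately show False using Y(2,3) by simp
      qed
      have "Range (h' O g') \<inter> F \<subseteq> g' `` (Range h' \<inter> Z)"
      proof
        fix y assume "y \<in> Range (h' O g') \<inter> F"
        then obtain x z where y: "(x, z) \<in> h'" "(z, y) \<in> g'" "y \<in> F" by blast
        then obtain z0 where z0: "(z0, y) \<in> g" using ranF by blast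
        then have "(z0, y) \<in> g'" using g'c(2) y(3) by (auto simp: P_def)
        then have "z0 = z" using charts_eqD(2)[OF g'c(1) y(2)] by blast
        then have "z \<in> Z" using z0 y(3) by (force simp: Z_def)
        then show "y \<in> g' `` (Range h' \<inter> Z)" using y by blast
      qed
      then have "card (Range (h' O g') \<inter> F) \<le> card (Range h' \<inter> Z)"
        using card_Image_chart[OF g'c(1), of "Range h' \<inter> Z"] Z by (meson card_Image_chart(1) card_mono finite_Int le_trans g'c(1))
      then show "card (Range (h' O g') \<inter> F) \<le> k" using h' by (simp add: U_def)
    qed
  qed
next
  \<comment> \<open>Here \<open>Range g\<close> has fewer than \<open>k\<close> points; the bound
    holds for \<open>g\<close> itself and passes to all products \<open>h' O g'\<close>, with no
    condition on \<open>h'\<close>.\<close>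
  case False
  have fin: "finite (Range g)"
  proof (rule ccontr)
    assume "infinite (Range g)"
    then show False using infinite_arbitrarily_large[of "Range g" k] False by blast
  qed
  have "card (Range g) \<le> k"
  proof (rule ccontr)
    assume "\<not> card (Range g) \<le> k"
    then show False using obtain_subset_with_card_n[of k "Range g"] False by (metis nat_le_linear)
  qed
  then have gk: "card (Range g \<inter> F) \<le> k" using card_mono[OF fin, of "Range g \<inter> F"] by simp
  show thesis
  proof
    show "openin (range_bound_topology k) charts"
      using openin_topspace[of "range_bound_topology k"] by (simp add: topspace_range_bound)
    show "openin (range_bound_topology k) {g' \<in> charts. card (Range g' \<inter> F) \<le> k}"
      using F by (rule open_range_bound(3))
    show "h \<in> charts" "g \<in> {g' \<in> charts. card (Range g' \<inter> F) \<le> k}" using h g gk by auto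
    show "\<forall>h'\<in>charts. \<forall>g'\<in>{g' \<in> charts. card (Range g' \<inter> F) \<le> k}. card (Range (h' O g') \<inter> F) \<le> k"
    proof (intro ballI)
      fix h' g' assume "g' \<in> {g' \<in> charts. card (Range g' \<inter> F) \<le> k}"
      moreover have "card (Range (h' O g') \<inter> F) \<le> card (Range g' \<inter> F)"
        using F by (intro card_mono) auto
      ultimately show "card (Range (h' O g') \<inter> F) \<le> k" by simp
    qed
  qed
qed

text \<open>The coordinates take discrete values, so it is enough that each coordinate of the
  product is locally constant in the pair of factors.\<close>

lemma continuous_mult_range_bound:
  "continuous_map (prod_topology (range_bound_topology k) (range_bound_topology k))
     (range_bound_topology k) (\<lambda>(x, y). x O y)"
proof -
  let ?T = "range_bound_topology k"
  let ?P = "prod_topology ?T ?T"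
  have top: "topspace ?P = charts \<times> charts" by (simp add: topspace_range_bound)
  have all: "openin ?T charts"
    using openin_topspace[of ?T] by (simp add: topspace_range_bound)
  have nbhds: "\<exists>U V. openin ?T U \<and> openin ?T V \<and> h \<in> U \<and> g \<in> V \<and>
      (\<forall>h'\<in>U. \<forall>g'\<in>V. coords k (h' O g') i = coords k (h O g) i)"
    if h: "h \<in> charts" and g: "g \<in> charts" for h g i
  proof (cases i)
    case (Inl x)
    have c: "h' O g' \<in> charts" if "h' \<in> charts" "g' \<in> charts" for h' g'
      using that by (rule relcomp_charts)
    consider "x \<notin> Domain h" | z where "(x, z) \<in> h" "z \<notin> Domain g" | z y where "(x, z) \<in> h" "(z, y) \<in> g"
      by blast
    then show ?thesis
    proof cases
      case 1
      have "coords k (h' O g') i = 0" if "h' \<in> charts" "x \<notin> Domain h'" "g' \<in> charts" for h' g'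
        unfolding Inl coords_Inl(2)[OF c[OF that(1,3)]] using that(2) by blast
      then show ?thesis
        using 1 h g all open_range_bound(2)
        by (intro exI[of _ "{h' \<in> charts. x \<notin> Domain h'}"] exI[of _ charts]) auto
    next
      case 2
      have "coords k (h' O g') i = 0"
        if "h' \<in> charts" "(x, z) \<in> h'" "g' \<in> charts" "z \<notin> Domain g'" for h' g'
        unfolding Inl coords_Inl(2)[OF c[OF that(1,3)]]
        using that(2,4) charts_eqD(1)[OF that(1,2)] by blast
      then show ?thesis
        using 2 h g open_range_bound(1,2)
        by (intro exI[of _ "{h' \<in> charts. (x, z) \<in> h'}"] exI[of _ "{g' \<in> charts. z \<notin> Domain g'}"]) auto
    next
      case 3
      have "coords k (h' O g') i = Suc y"
        if "h' \<in> charts" "(x, z) \<in> h'" "g' \<in> charts" "(z, y) \<in> g'" for h' g'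
        unfolding Inl coords_Inl(1)[OF c[OF that(1,3)]] using that(2,4) by blast
      then show ?thesis
        using 3 h g open_range_bound(1)
        by (intro exI[of _ "{h' \<in> charts. (x, z) \<in> h'}"] exI[of _ "{g' \<in> charts. (z, y) \<in> g'}"]) auto
    qed
  next
    case (Inr j)
    define F where "F = set_decode j"
    have F: "finite F" by (simp add: F_def)
    have cj: "coords k f i = (if card (Range f \<inter> F) \<le> k then 0 else 1)" for f
      by (simp add: coords_def Inr F_def)
    show ?thesis
    proof (cases "card (Range (h O g) \<inter> F) \<le> k")
      case True
      obtain U V where "openin ?T U" "openin ?T V"
        "h \<in> U" "g \<in> V" "\<forall>h'\<in>U. \<forall>g'\<in>V. card (Range (h' O g') \<inter> F) \<le> k"
        using range_relcomp_nbhds[OF h g F True] by blast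
      then show ?thesis
        using True by (intro exI[of _ U] exI[of _ V]) (auto simp: cj)
    next
      case False
      \<comment> \<open>Exceeding \<open>k\<close> is witnessed by finitely many pairs: those of
        \<open>g\<close> ending in \<open>F\<close> and those of \<open>h\<close> leading to
        them.\<close>
      define G where "G = {p \<in> g. snd p \<in> F}"
      define H where "H = {p \<in> h. snd p \<in> fst ` G}"
      have G: "finite G" unfolding G_def by (rule finite_preimage_chart[OF g F])
      have H: "finite H" unfolding H_def using G by (intro finite_preimage_chart[OF h]) simp
      have "\<not> card (Range (h' O g') \<inter> F) \<le> k" if "H \<subseteq> h'" "G \<subseteq> g'" for h' g'
      proof -
        have "Range (h O g) \<inter> F \<subseteq> Range (h' O g') \<inter> F"
        proof
          fix y assume "y \<in> Range (h O g) \<inter> F"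
          then obtain x z where y: "(x, z) \<in> h" "(z, y) \<in> g" "y \<in> F" by blast
          then have "(z, y) \<in> G" "(x, z) \<in> H" by (force simp: G_def H_def)+
          then show "y \<in> Range (h' O g') \<inter> F" using that y(3) by blast
        qed
        then have "card (Range (h O g) \<inter> F) \<le> card (Range (h' O g') \<inter> F)"
          using F by (intro card_mono) auto
        then show ?thesis using False by simp
      qed
      then show ?thesis
        using False h g open_range_bound_superset[OF G] open_range_bound_superset[OF H]
        by (intro exI[of _ "{h' \<in> charts. H \<subseteq> h'}"] exI[of _ "{g' \<in> charts. G \<subseteq> g'}"])
          (auto simp: cj G_def H_def)
    qed
  qed
  have comp: "continuous_map ?P euclidean (\<lambda>p. (coords k \<circ> (\<lambda>(x, y). x O y)) p i)" for i
    unfolding continuous_map_def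
  proof (intro conjI allI impI)
    fix W :: "nat set" assume "openin euclidean W"
    define S where "S = {p \<in> topspace ?P. (coords k \<circ> (\<lambda>(x, y). x O y)) p i \<in> W}"
    have S_iff: "(h, g) \<in> S \<longleftrightarrow> h \<in> charts \<and> g \<in> charts \<and> coords k (h O g) i \<in> W" for h g
      by (auto simp: S_def topspace_range_bound)
    have "\<exists>U V. openin ?T U \<and> openin ?T V \<and> h \<in> U \<and> g \<in> V \<and> U \<times> V \<subseteq> S" if "(h, g) \<in> S" for h g
    proof -
      have hg: "h \<in> charts" "g \<in> charts" "coords k (h O g) i \<in> W" using that S_iff by auto
      obtain U V where UV: "openin ?T U" "openin ?T V" "h \<in> U" "g \<in> V"
        "\<forall>h'\<in>U. \<forall>g'\<in>V. coords k (h' O g') i = coords k (h O g) i"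
        using nbhds[OF hg(1,2), of i] by blast
      have sub: "U \<subseteq> charts" "V \<subseteq> charts"
        using openin_subset[OF UV(1)] openin_subset[OF UV(2)] by (simp_all add: topspace_range_bound)
      have "(h', g') \<in> S" if "h' \<in> U" "g' \<in> V" for h' g'
      proof -
        have "coords k (h' O g') i \<in> W" using UV(5) that hg(3) by metis
        then show ?thesis using that sub unfolding S_iff by blast
      qed
      then have "U \<times> V \<subseteq> S" by (intro subsetI) (metis mem_Sigma_iff surj_pair)
      with UV(1-4) show ?thesis by (intro exI[of _ U] exI[of _ V] conjI)
    qed
    then have "openin ?P S" by (subst openin_prod_topology_alt) blast
    then show "openin ?P {p \<in> topspace ?P. (coords k \<circ> (\<lambda>(x, y). x O y)) p i \<in> W}"
      by (simp only: S_def)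
  qed simp
  have "continuous_map ?P (product_topology (\<lambda>_. euclidean) UNIV) (coords k \<circ> (\<lambda>(x, y). x O y))"
    unfolding continuous_map_componentwise_UNIV using comp by (rule allI)
  then have "continuous_map ?P euclidean (coords k \<circ> (\<lambda>(x, y). x O y))"
    by (simp only: euclidean_product_topology)
  then have "continuous_map ?P (pullback_topology charts (coords k) euclidean) (\<lambda>(x, y). x O y)"
  proof (rule continuous_map_pullback')
    show "topspace ?P \<subseteq> (\<lambda>(x, y). x O y) -` charts"
    proof
      fix p assume "p \<in> topspace ?P"
      then obtain x y where "p = (x, y)" "x \<in> charts" "y \<in> charts" unfolding top by blast
      then show "p \<in> (\<lambda>(x, y). x O y) -` charts" using relcomp_charts[of x y] by simp
    qed
  qed
  then show ?thesis
    by (simp only: range_bound_topology_def)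
qed

section \<open>Polishness of the range bound topologies\<close>

lemma open_coords2: "open {\<phi> :: 'a \<Rightarrow> nat. P (\<phi> i) (\<phi> j)}"
proof -
  have "{\<phi> :: 'a \<Rightarrow> nat. P (\<phi> i) (\<phi> j)} =
    (\<Union>(a, b)\<in>{(a, b). P a b}. {\<phi>. \<phi> i = a} \<inter> {\<phi>. \<phi> j = b})"
    by auto
  then show ?thesis using open_coord[of "\<lambda>v. v = _"] by (auto intro!: open_UN open_Int)
qed

lemma completely_metrizable_nat_functions:
  "completely_metrizable_space (euclidean :: ('a::countable \<Rightarrow> nat) topology)"
proof -
  have "(euclidean :: nat topology) = discrete_topology UNIV"
    by (simp add: topology_eq open_discrete)
  then have "completely_metrizable_space (euclidean :: nat topology)"
    by (simp add: completely_metrizable_space_discrete_topology)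
  then show ?thesis
    by (subst euclidean_product_topology[symmetric])
      (auto simp: completely_metrizable_space_product_topology)
qed

lemma second_countable_euclidean:
  "second_countable (euclidean :: 'a::second_countable_topology topology)"
proof -
  obtain B :: "'a set set" where B: "countable B" "topological_basis B"
    using ex_countable_basis by blast
  show ?thesis
    unfolding second_countable_def
  proof (intro exI[of _ B] conjI ballI allI impI)
    show "countable B" by fact
    show "openin euclidean V" if "V \<in> B" for V
      using topological_basis_open[OF B(2) that] by simp
    show "\<exists>V\<in>B. x \<in> V \<and> V \<subseteq> U" if "openin euclidean U \<and> x \<in> U" for U and x :: 'a
      using topological_basisE[OF B(2), of U x] that by (metis open_openin)
  qed
qed

text \<open>A function is in the image when its \<open>Inl\<close> part is injective where nonzero
  (\<open>J\<close>) and every \<open>Inr\<close> entry is the correct bit for the range read off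
  from the \<open>Inl\<close> part (\<open>G\<close>). More than \<open>k\<close> range points in a
  finite set is an open condition, witnessed by \<open>Suc k\<close> values, so its negation is
  closed and a G-delta set in a metrizable space; there are only countably many conditions.\<close>

lemma gdelta_coords_image: "gdelta_in euclidean (coords k ` charts)"
proof -
  define c where "c \<phi> j = card {y \<in> set_decode j. \<exists>x. \<phi> (Inl x) = Suc y}" for \<phi> :: "nat + nat \<Rightarrow> nat" and j
  define J where "J = (\<lambda>(x, x'). {\<phi> :: nat + nat \<Rightarrow> nat. x \<noteq> x' \<longrightarrow> \<phi> (Inl x) \<noteq> 0 \<longrightarrow> \<phi> (Inl x) \<noteq> \<phi> (Inl x')})"
  define G where "G j = ({\<phi> :: nat + nat \<Rightarrow> nat. \<phi> (Inr j) = 0} \<inter> {\<phi>. c \<phi> j \<le> k}) \<union>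
    ({\<phi>. \<phi> (Inr j) = 1} \<inter> - {\<phi>. c \<phi> j \<le> k})" for j
  have opc: "open (- {\<phi>. c \<phi> j \<le> k})" for j
  proof -
    have "- {\<phi>. c \<phi> j \<le> k} =
      (\<Union>S\<in>{S. S \<subseteq> set_decode j \<and> card S = Suc k}. \<Inter>y\<in>S. \<Union>x. {\<phi>. \<phi> (Inl x) = Suc y})" (is "?L = ?R")
    proof (intro equalityI subsetI)
      fix \<phi> assume "\<phi> \<in> ?L"
      then have "Suc k \<le> card {y \<in> set_decode j. \<exists>x. \<phi> (Inl x) = Suc y}" by (simp add: c_def)
      then obtain S where "S \<subseteq> {y \<in> set_decode j. \<exists>x. \<phi> (Inl x) = Suc y}" "card S = Suc k"
        by (rule obtain_subset_with_card_n)
      then show "\<phi> \<in> ?R" by (intro UN_I[of S]) auto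
    next
      fix \<phi> assume "\<phi> \<in> ?R"
      then obtain S where "S \<subseteq> set_decode j" "card S = Suc k" "\<forall>y\<in>S. \<exists>x. \<phi> (Inl x) = Suc y"
        by auto
      then have S: "S \<subseteq> {y \<in> set_decode j. \<exists>x. \<phi> (Inl x) = Suc y}" "card S = Suc k" by auto
      then have "Suc k \<le> c \<phi> j" unfolding c_def S(2)[symmetric] by (intro card_mono) auto
      then show "\<phi> \<in> ?L" by simp
    qed
    moreover have "open ?R"
    proof (intro open_UN ballI open_INT)
      fix S assume "S \<in> {S. S \<subseteq> set_decode j \<and> card S = Suc k}"
      then show "finite S" using finite_subset finite_set_decode by blast
      fix y x show "open {\<phi>. \<phi> (Inl x) = Suc y}" by (rule open_coord)
    qed
    ultimately show ?thesis by simp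
  qed
  have met: "metrizable_space (euclidean :: (nat + nat \<Rightarrow> nat) topology)"
    by (intro completely_metrizable_imp_metrizable_space completely_metrizable_nat_functions)
  have "gdelta_in euclidean (J p)" for p
    by (cases p) (auto simp: J_def intro!: open_imp_gdelta_in open_coords2)
  moreover have "gdelta_in euclidean (G j)" for j
  proof -
    have "gdelta_in euclidean {\<phi> :: nat + nat \<Rightarrow> nat. \<phi> (Inr j) = v}" for v
      by (rule open_imp_gdelta_in) (use open_coord[of "\<lambda>w. w = v" "Inr j"] in simp)
    moreover have "gdelta_in euclidean {\<phi>. c \<phi> j \<le> k}"
      by (rule closed_imp_gdelta_in[OF met]) (use opc[of j] in \<open>simp add: closed_def\<close>)
    moreover have "gdelta_in euclidean (- {\<phi>. c \<phi> j \<le> k})"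
      by (rule open_imp_gdelta_in) (use opc[of j] in simp)
    ultimately show ?thesis
      unfolding G_def by (intro gdelta_in_Un gdelta_in_Int)
  qed
  ultimately have "gdelta_in euclidean (\<Inter>(range J \<union> range G))"
    by (intro gdelta_in_Inter) auto
  moreover have "coords k ` charts = \<Inter>(range J \<union> range G)"
  proof (intro equalityI subsetI)
    fix \<phi> assume "\<phi> \<in> coords k ` charts"
    then obtain h where h: "h \<in> charts" "\<phi> = coords k h" by blast
    have mem: "\<phi> (Inl x) = Suc y \<longleftrightarrow> (x, y) \<in> h" for x y
      using coords_Inl(1)[OF h(1)] h(2) by simp
    have "x = x'" if ne: "\<phi> (Inl x) \<noteq> 0" "\<phi> (Inl x) = \<phi> (Inl x')" for x x'
    proof -
      obtain y where "\<phi> (Inl x) = Suc y" using not0_implies_Suc[OF ne(1)] by blast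
      then have "(x, y) \<in> h" "(x', y) \<in> h" using mem ne(2) by metis+
      then show ?thesis using charts_eqD(2)[OF h(1)] by blast
    qed
    then have "\<phi> \<in> J (x, x')" for x x' by (auto simp: J_def)
    moreover have "{y \<in> set_decode j. \<exists>x. \<phi> (Inl x) = Suc y} = Range h \<inter> set_decode j" for j
      unfolding mem by blast
    then have "\<phi> \<in> G j" for j
      unfolding G_def c_def by (auto simp: h(2) coords_def)
    ultimately show "\<phi> \<in> \<Inter>(range J \<union> range G)" by auto
  next
    fix \<phi> assume \<phi>: "\<phi> \<in> \<Inter>(range J \<union> range G)"
    define h where "h = {(x, y). \<phi> (Inl x) = Suc y}"
    have J: "x = x'" if "\<phi> (Inl x) = Suc y" "\<phi> (Inl x') = Suc y" for x x' y
    proof -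
      have "\<phi> \<in> J (x, x')" using \<phi> by blast
      then show ?thesis using that by (auto simp: J_def)
    qed
    have h: "h \<in> charts"
      by (rule chartsI) (auto simp: h_def dest: J)
    have "coords k h i = \<phi> i" for i
    proof (cases i)
      case (Inl x)
      show ?thesis
      proof (cases "\<phi> i")
        case 0
        then have "x \<notin> Domain h" by (auto simp: h_def Inl)
        then show ?thesis using coords_Inl(2)[OF h] Inl 0 by simp
      next
        case (Suc y)
        then have "(x, y) \<in> h" by (simp add: h_def Inl)
        then show ?thesis using coords_Inl(1)[OF h] Inl Suc by simp
      qed
    next
      case (Inr j)
      have "{y \<in> set_decode j. \<exists>x. \<phi> (Inl x) = Suc y} = Range h \<inter> set_decode j"
        by (auto simp: h_def)
      moreover have "\<phi> \<in> G j" using \<phi> by blast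
      ultimately show ?thesis by (auto simp: G_def c_def Inr coords_def)
    qed
    then show "\<phi> \<in> coords k ` charts" using h by (metis ext imageI)
  qed
  ultimately show ?thesis by simp
qed

lemma range_bound_homeomorphic:
  "range_bound_topology k homeomorphic_space subtopology euclidean (coords k ` charts)"
proof -
  have inj: "inj_on (coords k) charts"
  proof (rule inj_onI)
    fix f g assume fg: "f \<in> charts" "g \<in> charts" "coords k f = coords k g"
    have "(x, y) \<in> f \<longleftrightarrow> (x, y) \<in> g" for x y
      using coords_Inl(1)[OF fg(1)] coords_Inl(1)[OF fg(2)] fg(3) by metis
    then show "f = g" by auto
  qed
  have "homeomorphic_map (range_bound_topology k) (subtopology euclidean (coords k ` charts)) (coords k)"
  proof (rule bijective_open_imp_homeomorphic_map)
    have "continuous_map (range_bound_topology k) euclidean (id \<circ> coords k)"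
      unfolding range_bound_topology_def by (intro continuous_map_pullback) simp
    then show "continuous_map (range_bound_topology k) (subtopology euclidean (coords k ` charts)) (coords k)"
      by (simp add: continuous_map_in_subtopology topspace_range_bound)
    show "open_map (range_bound_topology k) (subtopology euclidean (coords k ` charts)) (coords k)"
      unfolding open_map_def range_bound_topology_def openin_pullback_topology
      by (auto simp: openin_subtopology)
  qed (auto simp: topspace_range_bound inj)
  then show ?thesis by (rule homeomorphic_map_imp_homeomorphic_space)
qed

lemma Polish_range_bound: "Polish_space (range_bound_topology k)"
  unfolding Polish_space_def
proof
  have "separable_space (subtopology (euclidean :: (nat + nat \<Rightarrow> nat) topology) (coords k ` charts))"
    by (intro second_countable_imp_separable_space second_countable_subtopology second_countable_euclidean)
  then show "separable_space (range_bound_topology k)"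
    using homeomorphic_separable_space[OF range_bound_homeomorphic] by blast
  have "completely_metrizable_space (subtopology (euclidean :: (nat + nat \<Rightarrow> nat) topology) (coords k ` charts))"
    by (intro completely_metrizable_space_gdelta_in completely_metrizable_nat_functions gdelta_coords_image)
  then show "completely_metrizable_space (range_bound_topology k)"
    using homeomorphic_completely_metrizable_space[OF range_bound_homeomorphic] by blast
qed

text \<open>The two topologies differ at the empty chart: in the one for \<open>l\<close>, charts
  with \<open>k + 1\<close> range points in a fixed finite set still converge to \<open>{}\<close>
  as their domains escape, since \<open>k + 1 \<le> l\<close>; the bound \<open>k\<close> excludes
  them.\<close>

lemma range_bound_topology_neq:
  assumes "k < l"
  shows "range_bound_topology k \<noteq> range_bound_topology l"
proof
  assume eq: "range_bound_topology k = range_bound_topology l"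
  define W where "W = {h \<in> charts. card (Range h \<inter> {..k}) \<le> k}"
  have "openin (range_bound_topology l) W"
    unfolding W_def eq[symmetric] by (rule open_range_bound(3)) simp
  then obtain U where U: "open U" "W = coords l -` U \<inter> charts"
    unfolding range_bound_topology_def openin_pullback_topology by auto
  have "{} \<in> charts" by (rule chartsI) auto
  then have "{} \<in> W" by (simp add: W_def)
  then have "coords l {} \<in> U" using U(2) by simp
  moreover have "openin (product_topology (\<lambda>_. euclidean) UNIV) U"
    using U(1) by (simp add: euclidean_product_topology)
  ultimately obtain X where X: "coords l {} \<in> (\<Pi>\<^sub>E i\<in>UNIV. X i)"
    "finite {i. X i \<noteq> topspace (euclidean :: nat topology)}" "(\<Pi>\<^sub>E i\<in>UNIV. X i) \<subseteq> U"
    using product_topology_open_contains_basis[of "\<lambda>_. euclidean" UNIV U "coords l {}"] by blast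
  have "finite (Inl -` {i. X i \<noteq> UNIV})"
    using X(2) by (intro finite_vimageI) (auto simp: inj_def)
  then obtain m where m: "Inl -` {i. X i \<noteq> UNIV} \<subseteq> {..<m}"
    using finite_nat_iff_bounded by blast
  \<comment> \<open>The shift by \<open>m\<close> avoids all domain points that the basic
    neighbourhood restricts, and the range fills \<open>{..k}\<close> with \<open>k + 1\<close>
    points, one too many for \<open>W\<close>.\<close>
  define h where "h = {(m + i, i) | i. i \<le> k}"
  have h: "h \<in> charts" by (rule chartsI) (auto simp: h_def)
  have ran: "Range h = {..k}" by (auto simp: h_def)
  have "coords l h i \<in> X i" for i
  proof (cases i)
    case (Inl x)
    show ?thesis
    proof (cases "x < m")
      case True
      then have "x \<notin> Domain h" by (auto simp: h_def)
      then have "coords l h i = coords l {} i" by (simp add: coords_def Inl)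
      then show ?thesis using X(1) by (simp add: PiE_iff)
    next
      case False
      then have "X i = UNIV" using m Inl by auto
      then show ?thesis by simp
    qed
  next
    case (Inr j)
    have "card (Range h \<inter> set_decode j) \<le> card {..k}" by (intro card_mono) (auto simp: ran)
    then have "coords l h i = coords l {} i" using assms by (simp add: coords_def Inr)
    then show ?thesis using X(1) by (simp add: PiE_iff)
  qed
  then have "coords l h \<in> U" using X(3) by (auto simp: PiE_iff)
  then have "h \<in> W" using U(2) h by simp
  then show False by (simp add: W_def ran)
qed

lemma infinite_Polish_chart_semigroup_topologies:
  "infinite {T :: (nat \<times> nat) set topology.
     Polish_space T \<and> semigroup_topology_on (sym_inv_monoid UNIV) (O) T}"
proof -
  have "inj range_bound_topology"
    using range_bound_topology_neq by (intro injI) (metis linorder_neqE_nat)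
  then have "infinite (range range_bound_topology)" by (rule range_inj_infinite)
  moreover have "range range_bound_topology \<subseteq> {T. Polish_space T \<and> semigroup_topology_on (sym_inv_monoid UNIV) (O) T}"
    by (auto simp: semigroup_topology_on_def Polish_range_bound topspace_range_bound continuous_mult_range_bound)
  ultimately show ?thesis
    using finite_subset by blast
qed

theorem corollary2p4:
  shows "countable {T :: (nat \<times> nat) set topology.
           Polish_space T \<and> semigroup_topology_on (sym_inv_monoid UNIV) (O) T} \<and>
         infinite {T :: (nat \<times> nat) set topology.
           Polish_space T \<and> semigroup_topology_on (sym_inv_monoid UNIV) (O) T}"
  by (rule conjI[OF countable_Polish_chart_semigroup_topologies
        infinite_Polish_chart_semigroup_topologies])

end
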